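(* Let $a,b,c$ be positive integers with $a\le b\le c$. Then $$L^*(H_{\mathrm d}(a,b,c))=\frac{1}{2^a}\prod_{j=1}^{a}\left[\frac{(j-1)!\,(b+2c-3a+3j)\,(b+c-2a+j)!}{(c-a+2j-1)!}\cdot\frac{(b+2c-3a+2j+1)_{j-1}\,(2b+c-3a+2j+1)_{j-1}}{(b-a+2j-1)!}\right].$$
   Context: Shifted factorial: $(\alpha)_k=\alpha(\alpha+1)\cdots(\alpha+k-1)$ for $k\ge1$, and $(\alpha)_0=1$. Triangular lattice: let $e=(1,0)$, $f=(1/2,\sqrt3/2)$, $g=f-e=(-1/2,\sqrt3/2)$, and consider the lattice $\mathbb Z e+\mathbb Z f$ with its tiling of the plane by unit equilateral triangles. A lozenge is the union of two unit triangles sharing an edge. A lozenge tiling of a region $R$ (a finite union of unit triangles) is a decomposition of $R$ into lozenges with disjoint interiors. $H(a,b,c)$ ($a,b,c$ positive integers) is the hexagon with vertices, in counterclockwise order, $0$ (southwestern corner), $be$ (southeastern corner), $be+af$ (eastern corner), $be+af+cg$ (northeastern corner), $af+cg$ (northwestern corner), $cg$ (western corner). Thus its horizontal sides have length $b$, the southeastern and northwestern sides have length $a$, and the northeastern and southwestern sides have length $c$. Maximal staircase at a corner $V$: let $p,q$ be the lengths of the two sides meeting at $V$, let $s,t$ be the unit vectors pointing from $V$ along these two sides (they form an angle of $120^\circ$), and let $m=\min(p,q)$. For $i,j\ge1$ let the cell $(i,j)$ be the lozenge with vertices $V+(i-1)s+(j-1)t$, $V+is+(j-1)t$, $V+is+jt$,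 $V+(i-1)s+jt$. The maximal staircase at $V$ is the union of all cells $(i,j)$ with $i,j\ge1$ and $i+j\le m$. The marked positions along the cut at $V$ are the $m$ cells $(i,j)$ with $i,j\ge1$ and $i+j=m+1$ (the lozenge positions fitting in the indentations of the zig-zag cut that removed the staircase). $H_{\mathrm d}(a,b,c)$ is the region obtained from $H(a,b,c)$ by removing the maximal staircases at the northwestern corner (where sides of lengths $a$ and $b$ meet) and at the eastern corner (where sides of lengths $a$ and $c$ meet). $L^*(H_{\mathrm d}(a,b,c))=\sum_T 2^{-k(T)}$, where $T$ ranges over all lozenge tilings of $H_{\mathrm d}(a,b,c)$ and $k(T)$ is the number of lozenges of $T$ that occupy marked positions along the cut at the northwestern corner (only). *)

theory Defs
  imports "HOL-Analysis.Analysis" "HOL-Library.Disjoint_Sets"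
begin

text \<open>The plane is identified with the complex numbers.\<close>

definition e_vec :: complex where "e_vec = 1"

definition f_vec :: complex where "f_vec = Complex (1/2) (sqrt 3 / 2)"

definition g_vec :: complex where "g_vec = f_vec - e_vec"

definition lattice :: "complex set" where
  "lattice = {of_int x * e_vec + of_int y * f_vec | x y. True}"

text \<open>A unit triangle is represented by the set of its three vertices, and a finite union of
  unit triangles by the set of these triangles. Two distinct unit triangles share an edge iff
  they have two common vertices. Since distinct unit triangles have disjoint interiors, a
  decomposition of a region into lozenges with disjoint interiors is a partition of its set of
  unit triangles into lozenges.\<close>

type_synonym triangle = "complex set"

definition unit_triangles :: "triangle set" where
  "unit_triangles =
     {{p, p + e_vec, p + f_vec} | p. p \<in> lattice} \<union>
     {{p, p + f_vec, p + g_vec} | p. p \<in> lattice}"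

definition lozenges :: "triangle set set" where
  "lozenges = {{t, u} | t u. t \<in> unit_triangles \<and> u \<in> unit_triangles \<and> t \<noteq> u \<and> card (t \<inter> u) = 2}"

definition lozenge_tilings :: "triangle set \<Rightarrow> triangle set set set" where
  "lozenge_tilings R = {T. T \<subseteq> lozenges \<and> partition_on R T}"

definition hexagon :: "nat \<Rightarrow> nat \<Rightarrow> nat \<Rightarrow> complex set" where
  "hexagon a b c = convex hull
     {0,
      of_nat b * e_vec,
      of_nat b * e_vec + of_nat a * f_vec,
      of_nat b * e_vec + of_nat a * f_vec + of_nat c * g_vec,
      of_nat a * f_vec + of_nat c * g_vec,
      of_nat c * g_vec}"

definition hexagon_region :: "nat \<Rightarrow> nat \<Rightarrow> nat \<Rightarrow> triangle set" where
  "hexagon_region a b c = {t \<in> unit_triangles. t \<subseteq> hexagon a b c}"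

text \<open>The arguments \<open>s\<close> and \<open>t\<close> are unit lattice vectors at an angle of 120 degrees. The cell
  then consists of two unit triangles, separated by its short diagonal from
  \<open>V + (i-1)s + (j-1)t\<close> to \<open>V + is + jt\<close>.\<close>

definition cell :: "complex \<Rightarrow> complex \<Rightarrow> complex \<Rightarrow> nat \<Rightarrow> nat \<Rightarrow> triangle set" where
  "cell V s t i j = {u \<in> unit_triangles. u \<subseteq>
     {V + (of_nat i - 1) * s + (of_nat j - 1) * t,
      V + of_nat i * s + (of_nat j - 1) * t,
      V + of_nat i * s + of_nat j * t,
      V + (of_nat i - 1) * s + of_nat j * t}}"

definition staircase :: "complex \<Rightarrow> complex \<Rightarrow> complex \<Rightarrow> nat \<Rightarrow> triangle set" where
  "staircase V s t m = \<Union> {cell V s t i j | i j. 1 \<le> i \<and> 1 \<le> j \<and> i + j \<le> m}"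

definition marked_positions :: "complex \<Rightarrow> complex \<Rightarrow> complex \<Rightarrow> nat \<Rightarrow> triangle set set" where
  "marked_positions V s t m = {cell V s t i j | i j. 1 \<le> i \<and> 1 \<le> j \<and> i + j = m + 1}"

definition nw_corner :: "nat \<Rightarrow> nat \<Rightarrow> nat \<Rightarrow> complex" where
  "nw_corner a b c = of_nat a * f_vec + of_nat c * g_vec"

definition east_corner :: "nat \<Rightarrow> nat \<Rightarrow> nat \<Rightarrow> complex" where
  "east_corner a b c = of_nat b * e_vec + of_nat a * f_vec"

text \<open>From the northwestern corner the sides of lengths \<open>a\<close> and \<open>b\<close> run along \<open>-f\<close> and \<open>e\<close>;
  from the eastern corner those of lengths \<open>a\<close> and \<open>c\<close> run along \<open>-f\<close> and \<open>g\<close>.\<close>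

definition H_d :: "nat \<Rightarrow> nat \<Rightarrow> nat \<Rightarrow> triangle set" where
  "H_d a b c = hexagon_region a b c
     - staircase (nw_corner a b c) (- f_vec) e_vec (min a b)
     - staircase (east_corner a b c) (- f_vec) g_vec (min a c)"

definition nw_marked :: "nat \<Rightarrow> nat \<Rightarrow> nat \<Rightarrow> triangle set set" where
  "nw_marked a b c = marked_positions (nw_corner a b c) (- f_vec) e_vec (min a b)"

definition L_star :: "nat \<Rightarrow> nat \<Rightarrow> nat \<Rightarrow> real" where
  "L_star a b c = (\<Sum>T \<in> lozenge_tilings (H_d a b c). 1 / 2 ^ card (T \<inter> nw_marked a b c))"

end

theory Submission
  imports Defs "Jordan_Normal_Form.Char_Poly"
begin

text \<open>Write the vertices of the lattice in the basis \<open>e\<close>, \<open>f\<close>. Every unit triangle has one edge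
  parallel to \<open>f\<close>: it lies on the left of an upward triangle and on the right of a downward one. With
  \<open>up v\<close> and \<open>down v\<close> denoting the triangles whose \<open>f\<close>-edge starts at \<open>v\<close>, the lozenges are the pairs
  of \<open>up v\<close> with \<open>down v\<close>, \<open>down (v + (1, 0))\<close> and \<open>down (v + (1, -1))\<close>. The lozenges of the last two
  kinds link up into paths with steps \<open>(1, 0)\<close> and \<open>(1, -1)\<close>. In the region \<open>H_d a b c\<close> they form \<open>a\<close>
  non-intersecting paths, which lead from the \<open>f\<close>-edges \<open>(a - c - i, a + c - i)\<close> of the northwestern
  zig-zag to the \<open>f\<close>-edges \<open>(b - a + j, 2a - 2j)\<close> of the eastern one, \<open>1 \<le> i, j \<le> a\<close>. A lozenge in a
  marked position is exactly a first step \<open>(1, 0)\<close> of one of these paths.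

  Hence \<open>L_star a b c\<close> is a determinant of weighted path numbers (\<open>tiling_sum_eq_fdet\<close>,
  \<open>L_star_eq_fdet\<close>). A path from the \<open>i\<close>-th source to the \<open>j\<close>-th sink has \<open>N = b + c - 2a + i + j\<close> steps,
  of which \<open>k = c - a + 2j - i\<close> are equal to \<open>(1, -1)\<close>, so the \<open>(i, j)\<close> entry is
  \<open>1/2 binom(N - 1, k) + binom(N - 1, k - 1) = (N + k)/2 * (N - 1)! / (k! (N - k)!)\<close>. The factor
  \<open>N + k = b + 2c - 3a + 3j\<close> depends on the column only. It comes out of the determinant and, together
  with the power of two, accounts for the linear factors of the formula.

  What remains is the determinant of \<open>(x + y + i + j - 1)! / ((x + 2i - j)! (y + 2j - i)!)\<close>,
  \<open>0 \<le> i, j < a\<close>, at \<open>x = b - a + 1\<close> and \<open>y = c - a + 1\<close>. Deleting the first or last row and column gives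
  determinants of the same family with shifted parameters, so the Desnanot-Jacobi identity
  (\<open>desnanot_jacobi\<close>) is a recurrence in the size of the matrix. The product formula satisfies it by a
  polynomial identity of degree three (\<open>fdet_mrr_generic\<close>). The recurrence determines the determinant
  only where it can be divided by a smaller one. To keep that one away from zero, the factorials are
  replaced by Gamma functions and \<open>x\<close>, \<open>y\<close> are moved off the integers. Continuity then gives the
  value at integers (\<open>fdet_mrr\<close>).\<close>

section \<open>Determinants of matrices given by their entries\<close>

text \<open>Matrices are kept as functions on pairs of indices, so that passing to submatrices and shifting the
  parameters of a matrix are operations on functions.\<close>

definition fdet :: "nat \<Rightarrow> (nat \<Rightarrow> nat \<Rightarrow> 'a::comm_ring_1) \<Rightarrow> 'a" where
  "fdet n f = Determinant.det (Matrix.mat n n (\<lambda>(i, j). f i j))"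

definition minor :: "nat \<Rightarrow> nat \<Rightarrow> (nat \<Rightarrow> nat \<Rightarrow> 'a) \<Rightarrow> nat \<Rightarrow> nat \<Rightarrow> 'a" where
  "minor i j f r s = f (if r < i then r else Suc r) (if s < j then s else Suc s)"

lemma fdet_cong:
  "(\<And>i j. i < n \<Longrightarrow> j < n \<Longrightarrow> f i j = g i j) \<Longrightarrow> fdet n f = fdet n g"
  unfolding fdet_def by (rule arg_cong[of _ _ Determinant.det], rule eq_matI) auto

lemma fdet_eq_sum_permutes:
  "fdet n f = (\<Sum>p | p permutes {0..<n}. signof p * (\<Prod>i = 0..<n. f i (p i)))"
proof -
  have "fdet n f = (\<Sum>p | p permutes {0..<n}. signof p *
      (\<Prod>i = 0..<n. Matrix.mat n n (\<lambda>(i, j). f i j) $$ (i, p i)))"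
    unfolding fdet_def by (rule det_def') simp
  also have "\<dots> = (\<Sum>p | p permutes {0..<n}. signof p * (\<Prod>i = 0..<n. f i (p i)))"
  proof (rule sum.cong[OF refl])
    fix p assume "p \<in> {p. p permutes {0..<n}}"
    then have "(\<Prod>i = 0..<n. Matrix.mat n n (\<lambda>(i, j). f i j) $$ (i, p i)) = (\<Prod>i = 0..<n. f i (p i))"
      by (intro prod.cong) (auto dest: permutes_in_image)
    then show "signof p * (\<Prod>i = 0..<n. Matrix.mat n n (\<lambda>(i, j). f i j) $$ (i, p i))
        = signof p * (\<Prod>i = 0..<n. f i (p i))" by simp
  qed
  finally show ?thesis .
qed

lemma cofactor_mat:
  assumes "i < Suc n" "j < Suc n"
  shows "cofactor (Matrix.mat (Suc n) (Suc n) (\<lambda>(i, j). f i j)) i j = (-1) ^ (i + j) * fdet n (minor i j f)"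
proof -
  have "mat_delete (Matrix.mat (Suc n) (Suc n) (\<lambda>(i, j). f i j)) i j
      = Matrix.mat n n (\<lambda>(r, s). minor i j f r s)"
    by (rule eq_matI) (auto simp: mat_delete_def minor_def)
  then show ?thesis by (simp add: cofactor_def fdet_def)
qed

lemma fdet_expand_row:
  assumes "i < Suc n"
  shows "fdet (Suc n) f = (\<Sum>j<Suc n. f i j * ((-1) ^ (i + j) * fdet n (minor i j f)))"
  unfolding fdet_def[of "Suc n"]
  by (subst laplace_expansion_row[of _ "Suc n" i]) (use assms in \<open>auto simp: cofactor_mat simp del: sum.lessThan_Suc intro!: sum.cong\<close>)

lemma fdet_expand_column:
  assumes "j < Suc n"
  shows "fdet (Suc n) f = (\<Sum>i<Suc n. f i j * ((-1) ^ (i + j) * fdet n (minor i j f)))"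
  unfolding fdet_def[of "Suc n"]
  by (subst laplace_expansion_column[of _ "Suc n" j]) (use assms in \<open>auto simp: cofactor_mat simp del: sum.lessThan_Suc intro!: sum.cong\<close>)

text \<open>This is the row-by-row form of \<open>A * adj A = det A * 1\<close>: pairing row \<open>i\<close> with the cofactors of row \<open>j\<close> is
  the expansion of a determinant in which row \<open>j\<close> has been replaced by row \<open>i\<close>.\<close>

lemma fdet_expand_row_orthogonal:
  assumes "i < Suc n" "j < Suc n"
  shows "(\<Sum>k<Suc n. f i k * ((-1) ^ (j + k) * fdet n (minor j k f))) = (if i = j then fdet (Suc n) f else 0)"
proof -
  let ?A = "Matrix.mat (Suc n) (Suc n) (\<lambda>(i, j). f i j)"
  have "(?A * adj_mat ?A) $$ (i, j) = (Determinant.det ?A \<cdot>\<^sub>m 1\<^sub>m (Suc n)) $$ (i, j)"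
    using adj_mat(2)[of ?A "Suc n"] by simp
  moreover have "(?A * adj_mat ?A) $$ (i, j) = (\<Sum>k<Suc n. f i k * cofactor ?A j k)"
    using assms by (auto simp: adj_mat_def scalar_prod_def lessThan_atLeast0 simp del: sum.lessThan_Suc sum.atLeast0_lessThan_Suc intro!: sum.cong)
  moreover have "(\<Sum>k<Suc n. f i k * cofactor ?A j k)
      = (\<Sum>k<Suc n. f i k * ((-1) ^ (j + k) * fdet n (minor j k f)))"
    by (rule sum.cong) (use assms in \<open>auto simp: cofactor_mat\<close>)
  ultimately show ?thesis using assms by (auto simp: fdet_def)
qed

lemma fdet_mult: "fdet n f * fdet n g = fdet n (\<lambda>i j. \<Sum>k<n. f i k * g k j)"
proof -
  let ?A = "Matrix.mat n n (\<lambda>(i, j). f i j)" and ?B = "Matrix.mat n n (\<lambda>(i, j). g i j)"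
  have "?A * ?B = Matrix.mat n n (\<lambda>(i, j). \<Sum>k<n. f i k * g k j)"
    by (rule eq_matI) (auto simp: scalar_prod_def lessThan_atLeast0)
  then show ?thesis unfolding fdet_def by (metis det_mult mat_carrier)
qed

lemma fdet_identity: "fdet n (\<lambda>i j. if i = j then 1 else 0) = (1::'a::comm_ring_1)"
proof -
  have "Matrix.mat n n (\<lambda>(i, j). if i = j then 1 else 0) = (1\<^sub>m n :: 'a mat)"
    by (rule eq_matI) auto
  then show ?thesis by (simp add: fdet_def)
qed

lemma fdet_0 [simp]: "fdet 0 f = 1"
  by (simp add: fdet_eq_sum_permutes)

lemma fdet_lower_triangular:
  assumes "\<And>i j. i < j \<Longrightarrow> j < n \<Longrightarrow> f i j = 0"
  shows "fdet n f = (\<Prod>i<n. f i i)"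
  unfolding fdet_def
  by (subst det_lower_triangular[of n]) (auto simp: assms diag_mat_def  prod.list_conv_set_nth lessThan_atLeast0 intro!: prod.cong)

lemma fdet_first_column_unit:
  assumes "\<And>i. 0 < i \<Longrightarrow> i < Suc n \<Longrightarrow> f i 0 = 0"
  shows "fdet (Suc n) f = f 0 0 * fdet n (\<lambda>i j. f (Suc i) (Suc j))"
proof -
  have "fdet (Suc n) f = (\<Sum>i<Suc n. f i 0 * ((-1) ^ (i + 0) * fdet n (minor i 0 f)))"
    by (rule fdet_expand_column) simp
  also have "\<dots> = (\<Sum>i\<in>{0}. f i 0 * ((-1) ^ (i + 0) * fdet n (minor i 0 f)))"
    by (rule sum.mono_neutral_right) (use assms in auto)
  also have "\<dots> = f 0 0 * fdet n (minor 0 0 f)" by simp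
  also have "fdet n (minor 0 0 f) = fdet n (\<lambda>i j. f (Suc i) (Suc j))"
    by (rule fdet_cong) (simp add: minor_def)
  finally show ?thesis .
qed

lemma fdet_last_column_unit:
  assumes "\<And>i. i < n \<Longrightarrow> f i n = 0"
  shows "fdet (Suc n) f = f n n * fdet n f"
proof -
  have "fdet (Suc n) f = (\<Sum>i<Suc n. f i n * ((-1) ^ (i + n) * fdet n (minor i n f)))"
    by (rule fdet_expand_column) simp
  also have "\<dots> = (\<Sum>i\<in>{n}. f i n * ((-1) ^ (i + n) * fdet n (minor i n f)))"
    by (rule sum.mono_neutral_right) (use assms in auto)
  also have "\<dots> = f n n * fdet n (minor n n f)" by simp
  also have "fdet n (minor n n f) = fdet n f"
    by (rule fdet_cong) (simp add: minor_def)
  finally show ?thesis .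
qed

lemma fdet_first_row_last:
  assumes "\<And>j. j < n \<Longrightarrow> f 0 j = 0"
  shows "fdet (Suc n) f = (-1) ^ n * f 0 n * fdet n (\<lambda>i j. f (Suc i) j)"
proof -
  have "fdet (Suc n) f = (\<Sum>j<Suc n. f 0 j * ((-1) ^ (0 + j) * fdet n (minor 0 j f)))"
    by (rule fdet_expand_row) simp
  also have "\<dots> = (\<Sum>j\<in>{n}. f 0 j * ((-1) ^ (0 + j) * fdet n (minor 0 j f)))"
    by (rule sum.mono_neutral_right) (use assms in auto)
  also have "\<dots> = (-1) ^ n * f 0 n * fdet n (minor 0 n f)" by simp
  also have "fdet n (minor 0 n f) = fdet n (\<lambda>i j. f (Suc i) j)"
    by (rule fdet_cong) (simp add: minor_def)
  finally show ?thesis .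
qed

text \<open>Apart from its first and last columns the matrix is the identity, so only the four corner entries
  survive: its determinant is the two-by-two determinant of the corners.\<close>

lemma fdet_outer_columns:
  fixes u v :: "nat \<Rightarrow> 'a::comm_ring_1"
  shows "fdet (Suc (Suc n)) (\<lambda>k l. if l = 0 then u k else if l = Suc n then v k else if k = l then 1 else 0)
    = u 0 * v (Suc n) - u (Suc n) * v 0" (is "fdet _ ?B = _")
proof -
  let ?t = "\<lambda>j. ?B (Suc n) j * ((-1) ^ (Suc n + j) * fdet (Suc n) (minor (Suc n) j ?B))"
  have "fdet (Suc (Suc n)) ?B = (\<Sum>j<Suc (Suc n). ?t j)"
    by (rule fdet_expand_row) simp
  also have "\<dots> = (\<Sum>j\<in>{0, Suc n}. ?t j)"
    by (rule sum.mono_neutral_right) auto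
  also have "\<dots> = u (Suc n) * ((-1) ^ Suc n * fdet (Suc n) (minor (Suc n) 0 ?B))
      + v (Suc n) * fdet (Suc n) (minor (Suc n) (Suc n) ?B)"
    by simp
  also have "fdet (Suc n) (minor (Suc n) (Suc n) ?B) = (\<Prod>i<Suc n. minor (Suc n) (Suc n) ?B i i)"
    by (rule fdet_lower_triangular) (auto simp: minor_def)
  also have "\<dots> = (\<Prod>i<Suc n. if i = 0 then u 0 else 1)"
    by (rule prod.cong) (auto simp: minor_def)
  also have "\<dots> = u 0" by (subst prod.lessThan_Suc_shift) simp
  also have "fdet (Suc n) (minor (Suc n) 0 ?B) = (-1) ^ n * minor (Suc n) 0 ?B 0 n
      * fdet n (\<lambda>i j. minor (Suc n) 0 ?B (Suc i) j)"
    by (rule fdet_first_row_last) (simp add: minor_def)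
  also have "fdet n (\<lambda>i j. minor (Suc n) 0 ?B (Suc i) j) = fdet n (\<lambda>i j. if i = j then 1 else 0)"
    by (rule fdet_cong) (auto simp: minor_def)
  also have "\<dots> = 1" by (rule fdet_identity)
  also have "minor (Suc n) 0 ?B 0 n = v 0" by (simp add: minor_def)
  also have "u (Suc n) * ((-1) ^ Suc n * ((-1) ^ n * v 0 * 1)) + v (Suc n) * u 0 = u 0 * v (Suc n) - u (Suc n) * v 0"
    by (cases "even n") (auto simp: algebra_simps)
  finally show ?thesis .
qed

text \<open>Multiply the matrix by the matrix \<open>B\<close> that agrees with the adjugate in the first and last columns and
  with the identity elsewhere. In the product \<open>P\<close> the outer columns are the first and last unit vectors
  times the determinant \<open>d\<close>, and the inner columns are those of the given matrix; hence its determinant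
  is \<open>d\<^sup>2\<close> times the central minor. The determinant of \<open>B\<close> is a two-by-two determinant of cofactors, and one
  factor \<open>d\<close> cancels.\<close>

lemma desnanot_jacobi_nonsingular:
  fixes f :: "nat \<Rightarrow> nat \<Rightarrow> 'a::idom"
  assumes "fdet (Suc (Suc n)) f \<noteq> 0"
  shows "fdet (Suc (Suc n)) f * fdet n (\<lambda>i j. f (Suc i) (Suc j))
    = fdet (Suc n) f * fdet (Suc n) (\<lambda>i j. f (Suc i) (Suc j))
      - fdet (Suc n) (\<lambda>i j. f (Suc i) j) * fdet (Suc n) (\<lambda>i j. f i (Suc j))"
proof -
  let ?N = "Suc (Suc n)" and ?m = "Suc n"
  let ?d = "fdet ?N f" and ?mid = "fdet n (\<lambda>i j. f (Suc i) (Suc j))"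
  define C where "C i j = (-1) ^ (i + j) * fdet ?m (minor i j f)" for i j
  define B where "B = (\<lambda>k l. if l = 0 then C 0 k else if l = ?m then C ?m k else if k = l then 1 else (0::'a))"
  define P where "P = (\<lambda>i l. if l = 0 then (if i = 0 then ?d else 0)
                   else if l = ?m then (if i = ?m then ?d else 0) else f i l)"
  have P: "(\<Sum>k<?N. f i k * B k l) = P i l" if "i < ?N" "l < ?N" for i l
  proof -
    consider "l = 0" | "l = ?m" | "l \<noteq> 0" "l \<noteq> ?m" by blast
    then show ?thesis
    proof cases
      case 1
      then show ?thesis
        using fdet_expand_row_orthogonal[of i ?m 0 f] that
        by (simp add: B_def P_def C_def del: sum.lessThan_Suc)
    next
      case 2
      then show ?thesis
        using fdet_expand_row_orthogonal[of i ?m ?m f] that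
        by (simp add: B_def P_def C_def del: sum.lessThan_Suc)
    next
      case 3
      then show ?thesis
        using that by (simp add: B_def P_def if_distrib[of "\<lambda>x. _ * x"] cong: if_cong del: sum.lessThan_Suc)
    qed
  qed
  have "fdet ?N f * fdet ?N B = fdet ?N P"
    unfolding fdet_mult by (rule fdet_cong) (rule P)
  also have "fdet ?N P = P 0 0 * fdet ?m (\<lambda>i j. P (Suc i) (Suc j))"
    by (rule fdet_first_column_unit) (simp add: P_def)
  also have "fdet ?m (\<lambda>i j. P (Suc i) (Suc j)) = P ?m ?m * fdet n (\<lambda>i j. P (Suc i) (Suc j))"
    by (rule fdet_last_column_unit) (simp add: P_def)
  also have "fdet n (\<lambda>i j. P (Suc i) (Suc j)) = ?mid"
    by (rule fdet_cong) (simp add: P_def)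
  finally have "?d * fdet ?N B = ?d * (?d * ?mid)" by (simp add: P_def)
  then have "?d * ?mid = fdet ?N B" using assms by simp
  also have "\<dots> = C 0 0 * C ?m ?m - C 0 ?m * C ?m 0"
    unfolding B_def by (rule fdet_outer_columns)
  also have "C 0 0 = fdet ?m (\<lambda>i j. f (Suc i) (Suc j))"
    unfolding C_def by (simp, rule fdet_cong) (simp add: minor_def)
  also have "C ?m ?m = fdet ?m f"
    unfolding C_def by (simp, rule fdet_cong) (simp add: minor_def)
  also have "C 0 ?m = (-1) ^ ?m * fdet ?m (\<lambda>i j. f (Suc i) j)"
    unfolding C_def by (simp, rule fdet_cong) (simp add: minor_def)
  also have "C ?m 0 = (-1) ^ ?m * fdet ?m (\<lambda>i j. f i (Suc j))"
    unfolding C_def by (simp, rule fdet_cong) (simp add: minor_def)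
  finally show ?thesis
    by (cases "even n") (auto simp: algebra_simps)
qed

lemma poly_fdet: "poly (fdet n f) x = fdet n (\<lambda>i j. poly (f i j) x)"
  unfolding fdet_eq_sum_permutes by (auto simp: poly_sum poly_prod sign_def intro!: sum.cong)

text \<open>The case of a singular matrix follows by adding an indeterminate to the diagonal: the determinant
  becomes a characteristic polynomial, which is monic and therefore nonzero. Evaluate the identity at \<open>0\<close>.\<close>

lemma desnanot_jacobi:
  fixes f :: "nat \<Rightarrow> nat \<Rightarrow> 'a::idom"
  shows "fdet (Suc (Suc n)) f * fdet n (\<lambda>i j. f (Suc i) (Suc j))
    = fdet (Suc n) f * fdet (Suc n) (\<lambda>i j. f (Suc i) (Suc j))
      - fdet (Suc n) (\<lambda>i j. f (Suc i) j) * fdet (Suc n) (\<lambda>i j. f i (Suc j))"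
proof -
  let ?N = "Suc (Suc n)"
  define g where "g = (\<lambda>i j. [:f i j, if i = j then 1 else 0:])"
  let ?A = "Matrix.mat ?N ?N (\<lambda>(i, j). - f i j)"
  have "fdet ?N g = char_poly ?A"
    unfolding fdet_def char_poly_def g_def
    by (rule arg_cong[of _ _ Determinant.det], rule eq_matI) (auto simp: char_poly_matrix_def)
  moreover have "char_poly ?A \<noteq> 0"
    using degree_monic_char_poly[of ?A ?N] by auto
  ultimately have "fdet ?N g \<noteq> 0" by simp
  from arg_cong[OF desnanot_jacobi_nonsingular[OF this], of "\<lambda>p. poly p 0"]
  show ?thesis by (simp add: poly_fdet g_def)
qed

lemma fdet_row_linear:
  assumes "k < n"
  shows "fdet n (\<lambda>i j. if i = k then a * g j + b * h j else f i j)
    = a * fdet n (\<lambda>i j. if i = k then g j else f i j) + b * fdet n (\<lambda>i j. if i = k then h j else f i j)"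
proof -
  obtain m where n: "n = Suc m" using assms by (cases n) auto
  have minor: "minor k j (\<lambda>i j. if i = k then r j else f i j) = minor k j f" for r j
    by (auto simp: minor_def fun_eq_iff)
  show ?thesis
    using assms unfolding n
    by (subst (1 2 3) fdet_expand_row[of k])
       (simp_all add: minor distrib_right sum.distrib sum_distrib_left mult.assoc del: sum.lessThan_Suc)
qed

lemma fdet_zero_row:
  assumes "k < n" "\<And>j. j < n \<Longrightarrow> f k j = 0"
  shows "fdet n f = 0"
proof -
  obtain m where n: "n = Suc m" using assms(1) by (cases n) auto
  show ?thesis using assms unfolding n by (subst fdet_expand_row[of k]) (auto intro!: sum.neutral)
qed

lemma fdet_zero_column:
  assumes "k < n" "\<And>i. i < n \<Longrightarrow> f i k = 0"
  shows "fdet n f = 0"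
proof -
  obtain m where n: "n = Suc m" using assms(1) by (cases n) auto
  show ?thesis using assms unfolding n by (subst fdet_expand_column[of k]) (auto intro!: sum.neutral)
qed

lemma fdet_equal_rows:
  assumes "k < n" "l < n" "k \<noteq> l" "\<And>j. j < n \<Longrightarrow> f k j = f l j"
  shows "fdet n f = 0"
  unfolding fdet_def
  by (rule Determinant.det_identical_rows[of _ n k l]) (use assms in \<open>auto intro!: eq_vecI\<close>)

section \<open>The determinant of Mills, Robbins and Rumsey\<close>

text \<open>With \<open>1 / Gamma\<close> in place of the reciprocal factorials, the entries with a factorial of a negative number
  in the denominator vanish, and all entries are defined and continuous in real parameters with
  positive sum.\<close>

definition mrr_entry :: "real \<Rightarrow> real \<Rightarrow> nat \<Rightarrow> nat \<Rightarrow> real" where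
  "mrr_entry x y i j = Gamma (x + y + real i + real j) * rGamma (x + 2 * real i - real j + 1)
     * rGamma (y + 2 * real j - real i + 1)"

text \<open>The value of the determinant of size \<open>n\<close> is the product of the factors with index below \<open>n\<close>.\<close>

definition mrr_factor :: "real \<Rightarrow> real \<Rightarrow> nat \<Rightarrow> real" where
  "mrr_factor x y i = fact i * Gamma (x + y + real i)
     * pochhammer (2 * x + y + 2 * real i) i * pochhammer (x + 2 * y + 2 * real i) i
     * rGamma (x + 2 * real i + 1) * rGamma (y + 2 * real i + 1)"

definition mrr_product :: "nat \<Rightarrow> real \<Rightarrow> real \<Rightarrow> real" where
  "mrr_product n x y = (\<Prod>i<n. mrr_factor x y i)"

text \<open>Excluding integer values of these five linear forms makes every Gamma function, reciprocal Gamma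
  function and shifted factorial in the product formula finite and nonzero, for all integer shifts of \<open>x\<close>
  and \<open>y\<close> at once.\<close>

definition generic :: "real \<Rightarrow> real \<Rightarrow> bool" where
  "generic x y \<longleftrightarrow> x \<notin> \<int> \<and> y \<notin> \<int> \<and> x + y \<notin> \<int> \<and> 2 * x + y \<notin> \<int> \<and> x + 2 * y \<notin> \<int>"

lemma Ints_add_of_int_iff: "(x::real) + of_int k \<in> \<int> \<longleftrightarrow> x \<in> \<int>"
  by (metis Ints_add Ints_diff Ints_of_int add_diff_cancel_right')

lemma generic_shift:
  assumes "generic x y"
  shows "generic (x + of_int k) (y + of_int l)"
proof -
  have "2 * (x + of_int k) + (y + of_int l) = (2 * x + y) + of_int (2 * k + l)"
    "x + of_int k + 2 * (y + of_int l) = (x + 2 * y) + of_int (k + 2 * l)"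
    "x + of_int k + (y + of_int l) = (x + y) + of_int (k + l)" by simp_all
  then show ?thesis using assms unfolding generic_def
    by (simp only: Ints_add_of_int_iff simp_thms)
qed

lemma add_nat_notin_Ints: "(x::real) \<notin> \<int> \<Longrightarrow> x + real k \<notin> \<int>"
  using Ints_add_of_int_iff[of x "int k"] by simp

lemma Gamma_add_one: "(z::real) \<notin> \<int> \<Longrightarrow> Gamma (z + 1) = z * Gamma z"
  by (rule Gamma_plus1) (use nonpos_Ints_Int in blast)

lemma rGamma_step: "rGamma (z::real) = z * rGamma (z + 1)"
  by (simp add: rGamma_plus1)

text \<open>The shifted factorials on both sides are literally the same, because \<open>(x + 2, y - 1)\<close> shifts \<open>2x + y\<close> by
  \<open>3\<close> and fixes \<open>x + 2y\<close>, while \<open>(x - 1, y + 2)\<close> does the opposite and \<open>(x + 1, y + 1)\<close> shifts both by \<open>3\<close>.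
  Only the Gamma functions differ, by steps of the functional equation.\<close>

lemma mrr_factor_cross:
  assumes "generic x y"
  shows "mrr_factor (x + 2) (y - 1) m * mrr_factor (x - 1) (y + 2) m
      * ((x + y + real m + 1) * (x + 2 * real m + 2) * (y + 2 * real m + 2))
    = mrr_factor x y m * mrr_factor (x + 1) (y + 1) m
      * ((x + y + real m) * (x + 2 * real m) * (y + 2 * real m))"
proof -
  define s where "s = x + y + real m"
  define u where "u = x + 2 * real m"
  define v where "v = y + 2 * real m"
  have "s \<notin> \<int>" unfolding s_def using assms add_nat_notin_Ints by (simp add: generic_def)
  then have "s + 1 \<notin> \<int>" using add_nat_notin_Ints[of s 1] by simp
  have G: "Gamma (s + 1) = s * Gamma s" "Gamma (s + 2) = (s + 1) * (s * Gamma s)"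
    using Gamma_add_one[OF \<open>s \<notin> \<int>\<close>] Gamma_add_one[OF \<open>s + 1 \<notin> \<int>\<close>] by (simp_all add: add.assoc)
  have rG: "rGamma u = u * rGamma (u + 1)" "rGamma (u + 2) = (u + 2) * rGamma (u + 3)"
    "rGamma v = v * rGamma (v + 1)" "rGamma (v + 2) = (v + 2) * rGamma (v + 3)"
    using rGamma_step[of u] rGamma_step[of "u + 2"] rGamma_step[of v] rGamma_step[of "v + 2"]
    by (simp_all add: add.assoc)
  define p where "p = (\<lambda>z. pochhammer (z + 2 * real m) m)"
  have F: "mrr_factor (x + 2) (y - 1) m = fact m * Gamma (s + 1) * p (2 * x + y + 3) * p (x + 2 * y) * rGamma (u + 3) * rGamma v"
    "mrr_factor (x - 1) (y + 2) m = fact m * Gamma (s + 1) * p (2 * x + y) * p (x + 2 * y + 3) * rGamma u * rGamma (v + 3)"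
    "mrr_factor x y m = fact m * Gamma s * p (2 * x + y) * p (x + 2 * y) * rGamma (u + 1) * rGamma (v + 1)"
    "mrr_factor (x + 1) (y + 1) m = fact m * Gamma (s + 2) * p (2 * x + y + 3) * p (x + 2 * y + 3) * rGamma (u + 2) * rGamma (v + 2)"
    unfolding mrr_factor_def s_def u_def v_def p_def by (simp_all add: algebra_simps)
  have "x + y + real m + 1 = s + 1" "x + 2 * real m + 2 = u + 2" "y + 2 * real m + 2 = v + 2"
    by (simp_all add: s_def u_def v_def)
  then show ?thesis
    unfolding F G rG s_def[symmetric] u_def[symmetric] v_def[symmetric]
    by (simp only: G rG mult.assoc mult.commute mult.left_commute)
qed

text \<open>The quotient of the off-diagonal and the diagonal term in the Desnanot-Jacobi recurrence telescopes.\<close>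

lemma mrr_product_cross:
  assumes "generic x y"
  shows "mrr_product m (x + 2) (y - 1) * mrr_product m (x - 1) (y + 2)
      * ((x + y + real m) * (x + 2 * real m) * (y + 2 * real m))
    = (x + y) * x * y * (mrr_product m x y * mrr_product m (x + 1) (y + 1))"
proof (induction m)
  case 0
  then show ?case by (simp add: mrr_product_def)
next
  case (Suc m)
  define A where "A = mrr_product m (x + 2) (y - 1) * mrr_product m (x - 1) (y + 2)"
  define B where "B = mrr_product m x y * mrr_product m (x + 1) (y + 1)"
  define \<alpha> where "\<alpha> = mrr_factor (x + 2) (y - 1) m * mrr_factor (x - 1) (y + 2) m"
  define \<beta> where "\<beta> = mrr_factor x y m * mrr_factor (x + 1) (y + 1) m"
  define P where "P = (\<lambda>m. (x + y + real m) * (x + 2 * real m) * (y + 2 * real m))"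
  have IH: "A * P m = (x + y) * x * y * B" using Suc by (simp add: A_def B_def P_def)
  have "(x + y + real m + 1) * (x + 2 * real m + 2) * (y + 2 * real m + 2) = P (Suc m)"
    by (simp add: P_def algebra_simps)
  then have step: "\<alpha> * P (Suc m) = \<beta> * P m"
    using mrr_factor_cross[OF assms, of m] by (simp add: \<alpha>_def \<beta>_def P_def)
  have "A * \<alpha> * P (Suc m) = (A * P m) * \<beta>" using step by (simp add: mult.assoc mult.commute)
  also have "\<dots> = (x + y) * x * y * (B * \<beta>)" using IH by simp
  finally show ?case
    by (simp add: A_def B_def \<alpha>_def \<beta>_def P_def mrr_product_def mult.assoc mult.left_commute)
qed

lemma mrr_factor_Suc:
  assumes "generic x y"
  shows "mrr_factor x y (Suc n) * ((x + y + real (Suc n)) * (x + 2 * real (Suc n)) * (y + 2 * real (Suc n)))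
    = real (Suc n) * (2 * x + y + 2 * real (Suc n)) * (x + 2 * y + 2 * real (Suc n)) * mrr_factor (x + 1) (y + 1) n"
proof -
  define s where "s = x + y + real (Suc n)"
  define u where "u = x + 2 * real (Suc n)"
  define v where "v = y + 2 * real (Suc n)"
  define z where "z = 2 * x + y + 2 * real (Suc n)"
  define w where "w = x + 2 * y + 2 * real (Suc n)"
  have "s \<notin> \<int>" unfolding s_def using assms add_nat_notin_Ints[of "x+y" "Suc n"] by (simp add: generic_def)
  have F: "mrr_factor x y (Suc n) = (real (Suc n) * fact n) * Gamma s * (z * pochhammer (z + 1) n)
        * (w * pochhammer (w + 1) n) * rGamma (u + 1) * rGamma (v + 1)"
    unfolding mrr_factor_def s_def u_def v_def z_def w_def by (simp only: pochhammer_rec fact_Suc of_nat_mult)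
  have F': "mrr_factor (x + 1) (y + 1) n = fact n * Gamma (s + 1) * pochhammer (z + 1) n
        * pochhammer (w + 1) n * rGamma u * rGamma v"
    unfolding mrr_factor_def s_def u_def v_def z_def w_def by (simp add: algebra_simps)
  show ?thesis
    unfolding F F' s_def[symmetric] u_def[symmetric] v_def[symmetric] z_def[symmetric] w_def[symmetric]
      Gamma_add_one[OF \<open>s \<notin> \<int>\<close>] rGamma_step[of u] rGamma_step[of v]
    by (simp only: mult.assoc mult.commute mult.left_commute)
qed

lemma pochhammer_neq_0: "(z::real) \<notin> \<int> \<Longrightarrow> pochhammer z n \<noteq> 0"
  by (auto simp: pochhammer_eq_0_iff)

lemma rGamma_neq_0: "(z::real) \<notin> \<int> \<Longrightarrow> rGamma z \<noteq> 0"
  by (metis nonpos_Ints_Int rGamma_eq_zero_iff)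

lemma Gamma_neq_0: "(z::real) \<notin> \<int> \<Longrightarrow> Gamma z \<noteq> 0"
  by (metis nonpos_Ints_Int Gamma_eq_zero_iff)

lemma mrr_product_neq_0:
  assumes "generic x y"
  shows "mrr_product n x y \<noteq> 0"
proof -
  have "mrr_factor x y i \<noteq> 0" for i
  proof -
    have "x + y + real i \<notin> \<int>" "2 * x + y + 2 * real i \<notin> \<int>" "x + 2 * y + 2 * real i \<notin> \<int>"
      "x + 2 * real i + 1 \<notin> \<int>" "y + 2 * real i + 1 \<notin> \<int>"
      using assms add_nat_notin_Ints[of "x + y" i] add_nat_notin_Ints[of "2 * x + y" "2 * i"]
        add_nat_notin_Ints[of "x + 2 * y" "2 * i"] add_nat_notin_Ints[of x "2 * i + 1"]
        add_nat_notin_Ints[of y "2 * i + 1"]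
      by (simp_all add: generic_def add.assoc[symmetric])
    then show ?thesis unfolding mrr_factor_def
      by (simp add: pochhammer_neq_0 rGamma_neq_0 Gamma_neq_0)
  qed
  then show ?thesis by (simp add: mrr_product_def)
qed

text \<open>With \<open>m = n + 1\<close> and \<open>K = (x + y + m)(x + 2m)(y + 2m)\<close>, the right-hand side of the Desnanot-Jacobi
  identity, times \<open>K\<close>, is the diagonal term times \<open>K - (x + y) x y\<close>, by \<open>mrr_product_cross\<close>. This
  cubic factors as \<open>m (2x + y + 2m)(x + 2y + 2m)\<close>, and that is what the new factor of the product
  contributes by \<open>mrr_factor_Suc\<close>.\<close>

lemma fdet_mrr_generic:
  assumes "generic x y"
  shows "fdet n (mrr_entry x y) = mrr_product n x y"
  using assms
proof (induction n arbitrary: x y rule: induct_nat_012)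
  case 0
  then show ?case by (simp add: mrr_product_def)
next
  case 1
  then show ?case
    using fdet_first_column_unit[of 0 "mrr_entry x y"]
    by (simp add: mrr_product_def mrr_factor_def mrr_entry_def[of x y 0 0])
next
  case (ge2 n)
  define m where "m = Suc n"
  have gen: "generic (x + 1) (y + 1)" "generic (x + 2) (y - 1)" "generic (x - 1) (y + 2)"
    using generic_shift[OF ge2.prems, of 1 1] generic_shift[OF ge2.prems, of 2 "-1"]
      generic_shift[OF ge2.prems, of "-1" 2] by simp_all
  have shifts: "(\<lambda>i j. mrr_entry x y (Suc i) (Suc j)) = mrr_entry (x + 1) (y + 1)"
    "(\<lambda>i j. mrr_entry x y (Suc i) j) = mrr_entry (x + 2) (y - 1)"
    "(\<lambda>i j. mrr_entry x y i (Suc j)) = mrr_entry (x - 1) (y + 2)"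
    by (simp_all add: fun_eq_iff mrr_entry_def algebra_simps)
  let ?R = "mrr_product m x y" and ?R' = "mrr_product m (x + 1) (y + 1)"
  let ?Q = "mrr_product n (x + 1) (y + 1)"
  define K where "K = (x + y + real m) * (x + 2 * real m) * (y + 2 * real m)"
  have "x + y + real m \<notin> \<int>" "x + real (2 * m) \<notin> \<int>" "y + real (2 * m) \<notin> \<int>"
    using ge2.prems by (simp_all only: generic_def add_nat_notin_Ints not_False_eq_True)
  then have "x + y + real m \<noteq> 0" "x + 2 * real m \<noteq> 0" "y + 2 * real m \<noteq> 0"
    by (metis Ints_0, metis Ints_0 of_nat_mult of_nat_numeral, metis Ints_0 of_nat_mult of_nat_numeral)
  then have "K \<noteq> 0" unfolding K_def by simp
  have "fdet (Suc (Suc n)) (mrr_entry x y) * ?Q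
      = ?R * ?R' - mrr_product m (x + 2) (y - 1) * mrr_product m (x - 1) (y + 2)"
    using desnanot_jacobi[of n "mrr_entry x y"]
    unfolding shifts ge2.IH(1)[OF gen(1)] ge2.IH(2)[OF gen(1)] ge2.IH(2)[OF gen(2)]
      ge2.IH(2)[OF gen(3)] ge2.IH(2)[OF ge2.prems] m_def .
  then have "fdet (Suc (Suc n)) (mrr_entry x y) * ?Q * K
      = ?R * ?R' * K - mrr_product m (x + 2) (y - 1) * mrr_product m (x - 1) (y + 2) * K"
    by (simp add: left_diff_distrib)
  also have "\<dots> = ?R * ?R' * (K - (x + y) * x * y)"
    using mrr_product_cross[OF ge2.prems, of m] by (simp add: K_def algebra_simps)
  also have "K - (x + y) * x * y = real m * (2 * x + y + 2 * real m) * (x + 2 * y + 2 * real m)"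
    unfolding K_def by (simp add: algebra_simps)
  also have "?R' = ?Q * mrr_factor (x + 1) (y + 1) n"
    by (simp add: mrr_product_def m_def)
  also have "?R * (?Q * mrr_factor (x + 1) (y + 1) n) * (real m * (2 * x + y + 2 * real m) * (x + 2 * y + 2 * real m))
      = ?R * ?Q * (mrr_factor x y m * K)"
    using mrr_factor_Suc[OF ge2.prems, of n] unfolding m_def[symmetric] K_def[symmetric]
    by (simp add: mult.assoc mult.commute mult.left_commute)
  also have "\<dots> = mrr_product (Suc (Suc n)) x y * ?Q * K"
    by (simp add: mrr_product_def m_def)
  finally show ?case
    using \<open>K \<noteq> 0\<close> mrr_product_neq_0[OF gen(1), of n] by simp
qed

text \<open>Moving both parameters by the same \<open>t\<close> moves the five linear forms by \<open>t\<close>, \<open>2t\<close> or \<open>3t\<close>, which is why \<open>t\<close>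
  stays below \<open>1/3\<close>.\<close>

lemma generic_near_integers:
  assumes "0 < t" "t < 1/3"
  shows "generic (real_of_int k + t) (real_of_int l + t)"
proof -
  have *: "s + real_of_int i \<notin> \<int>" if "0 < s" "s < 1" for s i
  proof
    assume "s + real_of_int i \<in> \<int>"
    then have "s \<in> \<int>" by (simp add: Ints_add_of_int_iff)
    then obtain q where "s = of_int q" by (auto elim: Ints_cases)
    then show False using that by simp
  qed
  show ?thesis
    unfolding generic_def
    using *[of t k] *[of t l] *[of "2 * t" "k + l"] *[of "3 * t" "2 * k + l"] *[of "3 * t" "k + 2 * l"] assms
    by (simp add: algebra_simps)
qed

text \<open>Both sides are continuous where \<open>x + y > 0\<close>, so the generic case extends to integer parameters.\<close>

theorem fdet_mrr:
  fixes k l :: int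
  assumes "0 < k + l"
  shows "fdet n (mrr_entry (of_int k) (of_int l)) = mrr_product n (of_int k) (of_int l)"
proof -
  let ?F = "at_right (0::real)"
  let ?x = "\<lambda>t. of_int k + t :: real" and ?y = "\<lambda>t. of_int l + t :: real"
  have s: "real_of_int k + real_of_int l > 0" using assms by linarith
  have G: "((\<lambda>t. Gamma (?x t + ?y t + real i)) \<longlongrightarrow> Gamma (of_int k + of_int l + real i)) ?F" for i
    by (rule tendsto_Gamma) (use s in \<open>auto intro!: tendsto_eq_intros simp: not_le elim!: nonpos_Ints_cases dest: nonpos_Ints_nonpos\<close>)
  have rG: "(f \<longlongrightarrow> L) ?F \<Longrightarrow> ((\<lambda>t. rGamma (f t)) \<longlongrightarrow> rGamma L) ?F" for f :: "real \<Rightarrow> real" and L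
    by (rule isCont_tendsto_compose[of L rGamma]) (auto intro: isCont_rGamma)
  have xy: "(?x \<longlongrightarrow> of_int k) ?F" "(?y \<longlongrightarrow> of_int l) ?F"
    by (auto intro!: tendsto_eq_intros)
  have "((\<lambda>t. fdet n (mrr_entry (?x t) (?y t))) \<longlongrightarrow> fdet n (mrr_entry (of_int k) (of_int l))) ?F"
    unfolding fdet_eq_sum_permutes mrr_entry_def add.assoc[of _ "real _" "real _"] of_nat_add[symmetric]
    by (intro tendsto_intros G rG xy) 
  moreover have "((\<lambda>t. mrr_product n (?x t) (?y t)) \<longlongrightarrow> mrr_product n (of_int k) (of_int l)) ?F"
    unfolding mrr_product_def mrr_factor_def pochhammer_prod
    by (intro tendsto_intros G rG xy) 
  ultimately show ?thesis
  proof (intro tendsto_unique[OF trivial_limit_at_right_real Lim_transform_eventually])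
    show "\<forall>\<^sub>F t in ?F. fdet n (mrr_entry (?x t) (?y t)) = mrr_product n (?x t) (?y t)"
      by (rule eventually_at_rightI[of 0 "1/3"]) (auto intro!: fdet_mrr_generic generic_near_integers)
  qed
qed

section \<open>Sums over exact covers and over lozenge tilings\<close>

text \<open>Tilings by lozenges are the covers of interest, but their recursion by removal of one lozenge at a time
  holds for exact covers by members of any family of sets.\<close>

definition cover_sum :: "'a set set \<Rightarrow> ('a set \<Rightarrow> 'b::comm_semiring_1) \<Rightarrow> 'a set \<Rightarrow> 'b" where
  "cover_sum L w R = (\<Sum>T | T \<subseteq> L \<and> partition_on R T. \<Prod>l\<in>T. w l)"

lemma cover_sum_empty: "cover_sum L w {} = 1"
proof -
  have "{T. T \<subseteq> L \<and> partition_on {} T} = {{}}"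
    by (auto simp: partition_on_def)
  then show ?thesis by (simp add: cover_sum_def)
qed

lemma partition_on_insert_block:
  assumes "l \<noteq> {}" "l \<subseteq> R" "partition_on (R - l) T"
  shows "partition_on R (insert l T)" "l \<notin> T"
proof -
  have T: "\<Union>T = R - l" "disjoint T" "{} \<notin> T" using assms(3) by (auto simp: partition_on_def)
  then have "l \<inter> m = {}" if "m \<in> T" for m using that by blast
  then have "disjoint (insert l T)" using T(2) by (auto simp: disjoint_def)
  then show "partition_on R (insert l T)" using T assms(1,2) by (auto simp: partition_on_def)
  show "l \<notin> T" using T(1) assms(1) by blast
qed

lemma partition_on_remove_block:
  assumes "partition_on R T" "l \<in> T"
  shows "partition_on (R - l) (T - {l})"
proof -
  have "\<Union> (T - {l}) = R - l"
    using assms unfolding partition_on_def disjoint_def by fastforce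
  then show ?thesis using assms unfolding partition_on_def disjoint_def by auto
qed

lemma finite_covers: "finite R \<Longrightarrow> finite {T. T \<subseteq> L \<and> partition_on R T}"
  by (rule finite_subset[of _ "Pow (Pow R)"]) (auto simp: partition_on_def)

text \<open>Exactly one member of a cover contains the element \<open>t\<close>, and the other members cover the rest.\<close>

lemma cover_sum_peel:
  assumes "finite R" "t \<in> R"
  shows "cover_sum L w R = (\<Sum>l | l \<in> L \<and> t \<in> l \<and> l \<subseteq> R. w l * cover_sum L w (R - l))"
proof -
  let ?B = "{l. l \<in> L \<and> t \<in> l \<and> l \<subseteq> R}" and ?C = "\<lambda>R. {T. T \<subseteq> L \<and> partition_on R T}"
  let ?h = "\<lambda>(l, T). insert l T"
  have finB: "finite ?B" by (rule finite_subset[of _ "Pow R"]) (use assms in auto)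
  have inj: "inj_on ?h (Sigma ?B (\<lambda>l. ?C (R - l)))"
  proof (rule inj_onI, clarify)
    fix l l' T T'
    assume l: "t \<in> l" "l \<subseteq> R" "t \<in> l'" "l' \<subseteq> R"
      and T: "partition_on (R - l) T" "partition_on (R - l') T'" and eq: "insert l T = insert l' T'"
    have "t \<notin> \<Union>T'" "t \<notin> \<Union>T" using T l by (auto simp: partition_on_def)
    then have "l = l'" using eq l by blast
    moreover have "l \<notin> T" "l' \<notin> T'" using T l by (auto simp: partition_on_def)
    ultimately show "l = l' \<and> T = T'" using eq by (metis insert_ident)
  qed
  have image: "?h ` Sigma ?B (\<lambda>l. ?C (R - l)) = ?C R"
  proof (intro equalityI subsetI)
    fix S assume "S \<in> ?h ` Sigma ?B (\<lambda>l. ?C (R - l))"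
    then obtain l T where S: "S = insert l T" "l \<in> L" "t \<in> l" "l \<subseteq> R" "T \<subseteq> L" "partition_on (R - l) T"
      by auto
    then have "partition_on R S" using partition_on_insert_block(1)[of l R T] by auto
    then show "S \<in> ?C R" using S by simp
  next
    fix T assume T: "T \<in> ?C R"
    then obtain l where l: "l \<in> T" "t \<in> l" using assms by (auto simp: partition_on_def)
    then have "l \<in> ?B" using T by (auto simp: partition_on_def)
    moreover have "T - {l} \<in> ?C (R - l)" using T l partition_on_remove_block by auto
    ultimately have "(l, T - {l}) \<in> Sigma ?B (\<lambda>l. ?C (R - l))" by (rule SigmaI)
    moreover have "T = ?h (l, T - {l})" using l by auto
    ultimately show "T \<in> ?h ` Sigma ?B (\<lambda>l. ?C (R - l))" by (rule rev_image_eqI)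
  qed
  have "cover_sum L w R = (\<Sum>(l, T)\<in>Sigma ?B (\<lambda>l. ?C (R - l)). \<Prod>l\<in>insert l T. w l)"
    unfolding cover_sum_def image[symmetric] sum.reindex[OF inj] by (simp add: case_prod_unfold o_def)
  also have "\<dots> = (\<Sum>l\<in>?B. \<Sum>T\<in>?C (R - l). \<Prod>l\<in>insert l T. w l)"
    by (rule sum.Sigma[symmetric]) (use assms(1) finB in \<open>auto intro: finite_covers\<close>)
  also have "\<dots> = (\<Sum>l\<in>?B. w l * cover_sum L w (R - l))"
  proof (rule sum.cong[OF refl])
    fix l assume l: "l \<in> ?B"
    have "(\<Prod>l\<in>insert l T. w l) = w l * (\<Prod>l\<in>T. w l)" if T: "T \<in> ?C (R - l)" for T
    proof -
      have "finite T" using finite_elements[of "R - l" T] assms T by auto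
      moreover have "l \<notin> T" using partition_on_insert_block(2)[of l R T] l T by auto
      ultimately show ?thesis by simp
    qed
    then show "(\<Sum>T\<in>?C (R - l). \<Prod>l\<in>insert l T. w l) = w l * cover_sum L w (R - l)"
      unfolding cover_sum_def sum_distrib_left by (intro sum.cong) auto
  qed
  finally show ?thesis .
qed

type_synonym point = "int \<times> int"

text \<open>Coordinates with respect to the lattice basis \<open>e\<close>, \<open>f\<close>.\<close>

definition point :: "point \<Rightarrow> complex" where
  "point v = of_int (fst v) * e_vec + of_int (snd v) * f_vec"

definition up :: "point \<Rightarrow> triangle" where
  "up v = {point v, point (v + (1, 0)), point (v + (0, 1))}"

definition down :: "point \<Rightarrow> triangle" where
  "down v = {point v, point (v + (0, 1)), point (v + (-1, 1))}"

lemma point_add: "point (u + v) = point u + point v"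
  by (simp add: point_def algebra_simps)

lemma inj_point: "point u = point v \<longleftrightarrow> u = v"
proof
  assume eq: "point u = point v"
  have Re: "Re (point w) = of_int (fst w) + of_int (snd w) / 2"
    and Im: "Im (point w) = of_int (snd w) * (sqrt 3 / 2)" for w
    by (simp_all add: point_def e_vec_def f_vec_def)
  have "snd u = snd v" using arg_cong[OF eq, of Im] unfolding Im by simp
  moreover from this have "fst u = fst v" using arg_cong[OF eq, of Re] unfolding Re by simp
  ultimately show "u = v" by (simp add: prod_eq_iff)
qed simp

lemma lattice_eq: "Defs.lattice = range point"
proof (intro equalityI subsetI)
  fix p assume "p \<in> Defs.lattice"
  then obtain x y where "p = point (x, y)" unfolding Defs.lattice_def point_def fst_conv snd_conv by blast
  then show "p \<in> range point" by blast
next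
  fix p assume "p \<in> range point"
  then show "p \<in> Defs.lattice" unfolding Defs.lattice_def point_def by blast
qed

lemma unit_triangles_eq: "unit_triangles = range up \<union> range down"
proof -
  have "point (1, 0) = e_vec" "point (0, 1) = f_vec" "point (-1, 1) = g_vec"
    by (simp_all add: point_def g_vec_def)
  then have "up v = {point v, point v + e_vec, point v + f_vec}"
    "down v = {point v, point v + f_vec, point v + g_vec}" for v
    by (simp_all add: up_def down_def point_add)
  then show ?thesis unfolding unit_triangles_def lattice_eq by auto
qed

text \<open>The vertices of the two kinds of triangle in lattice coordinates, where coincidences between vertices
  are decided by linear integer arithmetic.\<close>

definition upc :: "point \<Rightarrow> point set" where
  "upc v = {v, v + (1, 0), v + (0, 1)}"

definition downc :: "point \<Rightarrow> point set" where
  "downc v = {v, v + (0, 1), v + (-1, 1)}"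

lemma up_eq: "up v = point ` upc v" and down_eq: "down v = point ` downc v"
  by (auto simp: up_def upc_def down_def downc_def)

lemma inj_on_point: "inj_on point A"
  by (simp add: inj_on_def inj_point)

lemma inj_map_point: "inj point"
  by (rule inj_on_point)

lemma up_inj: "up u = up v \<longleftrightarrow> u = v"
proof
  assume "up u = up v"
  then have "upc u = upc v" by (simp add: up_eq inj_image_eq_iff[OF inj_map_point])
  moreover have "u \<in> upc u" "v \<in> upc v" by (simp_all add: upc_def)
  ultimately have "u \<in> upc v" "v \<in> upc u" by simp_all
  then show "u = v" by (cases u; cases v) (auto simp: upc_def)
qed simp

lemma down_inj: "down u = down v \<longleftrightarrow> u = v"
proof
  assume "down u = down v"
  then have "downc u = downc v" by (simp add: down_eq inj_image_eq_iff[OF inj_map_point])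
  moreover have "u \<in> downc u" "v \<in> downc v" by (simp_all add: downc_def)
  ultimately have "u \<in> downc v" "v \<in> downc u" by simp_all
  then show "u = v" by (cases u; cases v) (auto simp: downc_def)
qed simp

lemma up_neq_down: "up u \<noteq> down v"
proof
  assume "up u = down v"
  then have "upc u = downc v" by (simp add: up_eq down_eq inj_image_eq_iff[OF inj_map_point])
  moreover have "u \<in> upc u" "u + (1, 0) \<in> upc u" "u + (0, 1) \<in> upc u" by (simp_all add: upc_def)
  ultimately have "u \<in> downc v" "u + (1, 0) \<in> downc v" "u + (0, 1) \<in> downc v" by simp_all
  then show False by (cases u; cases v) (auto simp: downc_def)
qed

text \<open>The three values of \<open>v\<close> belong to the edges of \<open>up u\<close> parallel to \<open>f\<close>, \<open>g\<close> and \<open>e\<close>, in this order.\<close>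

lemma up_down_adjacent_iff:
  "card (up u \<inter> down v) = 2 \<longleftrightarrow> v \<in> {u, u + (1, 0), u + (1, -1)}"
proof -
  have "card (up u \<inter> down v) = card (upc u \<inter> downc v)"
    unfolding up_eq down_eq image_Int[OF inj_map_point, symmetric] by (rule card_image[OF inj_on_point])
  also have "\<dots> = 2 \<longleftrightarrow> v \<in> {u, u + (1, 0), u + (1, -1)}"
  proof
    assume "card (upc u \<inter> downc v) = 2"
    then obtain p q where "p \<noteq> q" "upc u \<inter> downc v = {p, q}" by (auto simp: card_2_iff)
    then have "p \<in> upc u" "q \<in> upc u" "p \<in> downc v" "q \<in> downc v" "p \<noteq> q" by auto
    then show "v \<in> {u, u + (1, 0), u + (1, -1)}"
      by (cases u; cases v) (auto simp: upc_def downc_def)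
  next
    obtain x y where u: "u = (x, y)" by (cases u)
    have "upc u \<inter> downc u = {(x, y), (x, y + 1)}"
      "upc u \<inter> downc (u + (1, 0)) = {(x + 1, y), (x, y + 1)}"
      "upc u \<inter> downc (u + (1, -1)) = {(x + 1, y), (x, y)}"
      by (auto simp: u upc_def downc_def)
    then show "v \<in> {u, u + (1, 0), u + (1, -1)} \<Longrightarrow> card (upc u \<inter> downc v) = 2"
      by auto
  qed
  finally show ?thesis .
qed

lemma up_up_not_adjacent: "u \<noteq> v \<Longrightarrow> card (up u \<inter> up v) \<noteq> 2"
proof
  assume "u \<noteq> v"
  assume "card (up u \<inter> up v) = 2"
  moreover have "card (up u \<inter> up v) = card (upc u \<inter> upc v)"
    unfolding up_eq image_Int[OF inj_map_point, symmetric] by (rule card_image[OF inj_on_point])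
  ultimately obtain p q where "p \<noteq> q" "upc u \<inter> upc v = {p, q}" by (auto simp: card_2_iff)
  then have "p \<in> upc u" "q \<in> upc u" "p \<in> upc v" "q \<in> upc v" "p \<noteq> q" by auto
  then show False using \<open>u \<noteq> v\<close>
    by (cases u; cases v) (auto simp: upc_def)
qed

lemma down_down_not_adjacent: "u \<noteq> v \<Longrightarrow> card (down u \<inter> down v) \<noteq> 2"
proof
  assume "u \<noteq> v"
  assume "card (down u \<inter> down v) = 2"
  moreover have "card (down u \<inter> down v) = card (downc u \<inter> downc v)"
    unfolding down_eq image_Int[OF inj_map_point, symmetric] by (rule card_image[OF inj_on_point])
  ultimately obtain p q where "p \<noteq> q" "downc u \<inter> downc v = {p, q}" by (auto simp: card_2_iff)
  then have "p \<in> downc u" "q \<in> downc u" "p \<in> downc v" "q \<in> downc v" "p \<noteq> q" by auto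
  then show False using \<open>u \<noteq> v\<close>
    by (cases u; cases v) (auto simp: downc_def)
qed

lemma lozenges_eq: "lozenges = {{up u, down v} | u v. v \<in> {u, u + (1, 0), u + (1, -1)}}"
proof (intro equalityI subsetI)
  fix l assume "l \<in> lozenges"
  then obtain s t where l: "l = {s, t}" and st: "s \<in> unit_triangles" "t \<in> unit_triangles" "s \<noteq> t" "card (s \<inter> t) = 2"
    by (auto simp: lozenges_def)
  consider (uu) u v where "s = up u" "t = up v" | (dd) u v where "s = down u" "t = down v"
    | (ud) u v where "s = up u" "t = down v" | (du) u v where "s = down v" "t = up u"
    using st(1,2) unfolding unit_triangles_eq by blast
  then show "l \<in> {{up u, down v} | u v. v \<in> {u, u + (1, 0), u + (1, -1)}}"
  proof cases
    case uu
    then show ?thesis using st(3,4) up_up_not_adjacent[of u v] by metis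
  next
    case dd
    then show ?thesis using st(3,4) down_down_not_adjacent[of u v] by metis
  next
    case ud
    then show ?thesis using st(4) l up_down_adjacent_iff by blast
  next
    case du
    then have "l = {up u, down v}" "card (up u \<inter> down v) = 2" using l st(4) by (auto simp: Int_commute)
    then show ?thesis unfolding up_down_adjacent_iff by blast
  qed
next
  fix l assume "l \<in> {{up u, down v} | u v. v \<in> {u, u + (1, 0), u + (1, -1)}}"
  then obtain u v where l: "l = {up u, down v}" "v \<in> {u, u + (1, 0), u + (1, -1)}" by blast
  then have "card (up u \<inter> down v) = 2" unfolding up_down_adjacent_iff by simp
  moreover have "up u \<in> unit_triangles" "down v \<in> unit_triangles" unfolding unit_triangles_eq by simp_all
  ultimately show "l \<in> lozenges"
    unfolding lozenges_def using l(1) up_neq_down[of u v] by blast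
qed

definition tiling_sum :: "(triangle set \<Rightarrow> real) \<Rightarrow> point set \<Rightarrow> point set \<Rightarrow> real" where
  "tiling_sum w \<U> \<D> = cover_sum lozenges w (up ` \<U> \<union> down ` \<D>)"

lemma region_remove_lozenge:
  "up ` \<U> \<union> down ` \<D> - {up u, down v} = up ` (\<U> - {u}) \<union> down ` (\<D> - {v})"
proof -
  have "up ` \<U> - {up u, down v} = up ` (\<U> - {u})" by (auto simp: up_inj up_neq_down)
  moreover have "down ` \<D> - {up u, down v} = down ` (\<D> - {v})"
    by (auto simp: down_inj up_neq_down[symmetric])
  ultimately show ?thesis by (simp add: Un_Diff)
qed

lemma lozenge_subset_region:
  "{up u, down v} \<subseteq> up ` \<U> \<union> down ` \<D> \<longleftrightarrow> u \<in> \<U> \<and> v \<in> \<D>"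
proof -
  have "up u \<in> up ` \<U> \<union> down ` \<D> \<longleftrightarrow> u \<in> \<U>" by (auto simp: up_inj up_neq_down)
  moreover have "down v \<in> up ` \<U> \<union> down ` \<D> \<longleftrightarrow> v \<in> \<D>" by (auto simp: down_inj up_neq_down[symmetric])
  ultimately show ?thesis by simp
qed

lemma tiling_sum_peel_up:
  assumes "finite \<U>" "finite \<D>" "u \<in> \<U>"
  shows "tiling_sum w \<U> \<D> = (\<Sum>v\<in>{u, u + (1, 0), u + (1, -1)} \<inter> \<D>.
    w {up u, down v} * tiling_sum w (\<U> - {u}) (\<D> - {v}))"
proof -
  let ?R = "up ` \<U> \<union> down ` \<D>"
  have "{l. l \<in> lozenges \<and> up u \<in> l \<and> l \<subseteq> ?R}
      = (\<lambda>v. {up u, down v}) ` ({u, u + (1, 0), u + (1, -1)} \<inter> \<D>)"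
  proof (intro equalityI subsetI)
    fix l assume "l \<in> {l. l \<in> lozenges \<and> up u \<in> l \<and> l \<subseteq> ?R}"
    then obtain u' v where l: "l = {up u', down v}" "v \<in> {u', u' + (1, 0), u' + (1, -1)}"
      and "up u \<in> l" and "l \<subseteq> ?R" unfolding lozenges_eq by auto
    then have "u' = u" by (simp add: up_inj up_neq_down)
    moreover have "v \<in> \<D>" using \<open>l \<subseteq> ?R\<close> unfolding l(1) lozenge_subset_region by simp
    ultimately show "l \<in> (\<lambda>v. {up u, down v}) ` ({u, u + (1, 0), u + (1, -1)} \<inter> \<D>)"
      using l by blast
  next
    fix l assume "l \<in> (\<lambda>v. {up u, down v}) ` ({u, u + (1, 0), u + (1, -1)} \<inter> \<D>)"
    then obtain v where l: "l = {up u, down v}" "v \<in> {u, u + (1, 0), u + (1, -1)}" "v \<in> \<D>" by blast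
    then have "l \<in> lozenges" unfolding lozenges_eq by blast
    moreover have "l \<subseteq> ?R" unfolding l(1) lozenge_subset_region using l(3) assms(3) by simp
    ultimately show "l \<in> {l. l \<in> lozenges \<and> up u \<in> l \<and> l \<subseteq> ?R}" using l(1) by simp
  qed
  moreover have "inj_on (\<lambda>v. {up u, down v}) A" for A
    by (auto simp: inj_on_def doubleton_eq_iff down_inj up_neq_down)
  ultimately show ?thesis
    unfolding tiling_sum_def
    by (subst cover_sum_peel[of _ "up u"])
       (use assms in \<open>simp_all add: sum.reindex region_remove_lozenge del: insert_iff Int_insert_left\<close>)
qed

lemma tiling_sum_peel_down:
  assumes "finite \<U>" "finite \<D>" "v \<in> \<D>"
  shows "tiling_sum w \<U> \<D> = (\<Sum>u\<in>{v, v - (1, 0), v - (1, -1)} \<inter> \<U>.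
    w {up u, down v} * tiling_sum w (\<U> - {u}) (\<D> - {v}))"
proof -
  let ?R = "up ` \<U> \<union> down ` \<D>"
  have steps: "v \<in> {u, u + (1, 0), u + (1, -1)} \<longleftrightarrow> u \<in> {v, v - (1, 0), v - (1, -1)}" for u v :: point
    by (cases u; cases v) auto
  have "{l. l \<in> lozenges \<and> down v \<in> l \<and> l \<subseteq> ?R}
      = (\<lambda>u. {up u, down v}) ` ({v, v - (1, 0), v - (1, -1)} \<inter> \<U>)"
  proof (intro equalityI subsetI)
    fix l assume "l \<in> {l. l \<in> lozenges \<and> down v \<in> l \<and> l \<subseteq> ?R}"
    then obtain u v' where l: "l = {up u, down v'}" "u \<in> {v', v' - (1, 0), v' - (1, -1)}"
      and "down v \<in> l" and "l \<subseteq> ?R" unfolding lozenges_eq steps by auto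
    then have "v' = v" by (simp add: down_inj up_neq_down[symmetric])
    moreover have "u \<in> \<U>" using \<open>l \<subseteq> ?R\<close> unfolding l(1) lozenge_subset_region by simp
    ultimately show "l \<in> (\<lambda>u. {up u, down v}) ` ({v, v - (1, 0), v - (1, -1)} \<inter> \<U>)"
      using l by blast
  next
    fix l assume "l \<in> (\<lambda>u. {up u, down v}) ` ({v, v - (1, 0), v - (1, -1)} \<inter> \<U>)"
    then obtain u where l: "l = {up u, down v}" "u \<in> {v, v - (1, 0), v - (1, -1)}" "u \<in> \<U>" by blast
    then have "l \<in> lozenges" unfolding lozenges_eq steps by blast
    moreover have "l \<subseteq> ?R" unfolding l(1) lozenge_subset_region using l(3) assms(3) by simp
    ultimately show "l \<in> {l. l \<in> lozenges \<and> down v \<in> l \<and> l \<subseteq> ?R}" using l(1) by simp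
  qed
  moreover have "inj_on (\<lambda>u. {up u, down v}) A" for A
    by (auto simp: inj_on_def doubleton_eq_iff up_inj up_neq_down)
  ultimately show ?thesis
    unfolding tiling_sum_def
    by (subst cover_sum_peel[of _ "down v"])
       (use assms in \<open>simp_all add: sum.reindex region_remove_lozenge del: insert_iff Int_insert_left\<close>)
qed

section \<open>Non-intersecting lattice paths\<close>

text \<open>The order of two paths that are being traced step by step and may have advanced to different columns.
  If \<open>r\<close> is level with or ahead of \<open>q\<close>, a path from \<open>q\<close> descends by at most \<open>fst r - fst q\<close> before it
  reaches the column of \<open>r\<close>, and must still be above \<open>r\<close> there. If \<open>r\<close> is behind, a path from \<open>r\<close> can
  reach \<open>q\<close> at worst by staying on its level. This weak inequality suffices because such a collision is
  excluded separately.\<close>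

definition lies_above :: "point \<Rightarrow> point \<Rightarrow> bool" where
  "lies_above q r \<longleftrightarrow> (if fst q \<le> fst r then snd r - snd q < fst q - fst r else snd r \<le> snd q)"

abbreviation east :: "point \<Rightarrow> point" where "east v \<equiv> v + (1, 0)"
abbreviation southeast :: "point \<Rightarrow> point" where "southeast v \<equiv> v + (1, -1)"

lemma lies_above_asym: "lies_above q r \<Longrightarrow> \<not> lies_above r q"
  by (auto simp: lies_above_def split: if_splits)

lemma lies_above_step_upper:
  assumes "lies_above q r" "fst q \<le> fst r" "t = east q \<or> t = southeast q"
  shows "lies_above t r"
  using assms by (cases q; cases r) (auto simp: lies_above_def split: if_splits)

lemma lies_above_step_lower:
  assumes "lies_above q r" "fst r < fst q" "t = east r \<or> t = southeast r" "t \<noteq> q"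
  shows "lies_above q t"
  using assms by (cases q; cases r) (auto simp: lies_above_def split: if_splits)

lemma lies_above_irrefl: "\<not> lies_above q q"
  by (simp add: lies_above_def)

text \<open>There is no room for a strictly increasing self-map of \<open>{..<n}\<close> to skip a value.\<close>

lemma strict_mono_self_map_eq_id:
  fixes \<pi> :: "nat \<Rightarrow> nat"
  assumes "\<And>i. i < n \<Longrightarrow> \<pi> i < n" "\<And>i j. i < j \<Longrightarrow> j < n \<Longrightarrow> \<pi> i < \<pi> j" "i < n"
  shows "\<pi> i = i"
proof -
  \<comment> \<open>Every value grows by at least one per step, both down to \<open>0\<close> and up to \<open>n - 1\<close>.\<close>
  have gap: "j < n \<Longrightarrow> i \<le> j \<Longrightarrow> \<pi> i + (j - i) \<le> \<pi> j" for i j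
  proof (induction j)
    case (Suc j)
    then show ?case using assms(2)[of j "Suc j"] by (cases "i = Suc j") (auto simp: le_Suc_eq)
  qed simp
  have "i \<le> \<pi> i" using gap[of i 0] assms(3) by simp
  moreover have "\<pi> i + (n - 1 - i) \<le> \<pi> (n - 1)" using gap[of "n - 1" i] assms(3) by simp
  moreover have "\<pi> (n - 1) < n" using assms(1,3) by simp
  ultimately show ?thesis using assms(3) by linarith
qed

text \<open>A form of the Lindstroem-Gessel-Viennot theorem for regions \<open>\<U>\<close>, \<open>\<D>\<close> of upward and downward
  triangles, proved without a sign-reversing involution. The points \<open>q i\<close> are the current ends of
  partially traced paths, the points \<open>E j\<close> are the sinks, and \<open>p v j\<close> is the weighted number of paths
  from \<open>v\<close> to \<open>E j\<close>.

  The region is consumed from the left. A downward triangle in the leftmost column can only be joined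
  to the upward triangle at the same point. If there is none, it is a sink that no path reaches, and
  both sides vanish. If the leftmost column contains upward triangles only, they are ends of paths, and
  the uppermost one, \<open>q i\<close>, moves along one of its two steps. On the other side the recurrence for \<open>p\<close>
  splits row \<open>i\<close> of the determinant accordingly. A step that leaves the region yields a zero row by
  the assumption \<open>closed\<close>, and a step onto another path yields two equal rows, so the steps that are
  impossible for the tiling cancel in the determinant as well. When the region is exhausted, the ends
  are a permutation of the sinks. The relation \<open>lies_above\<close> is preserved throughout and forces this
  permutation to be the identity, so that no sign appears.\<close>

theorem tiling_sum_eq_fdet:
  fixes E :: "nat \<Rightarrow> point" and p :: "point \<Rightarrow> nat \<Rightarrow> real" and w :: "triangle set \<Rightarrow> real"
  assumes "finite \<U>" "finite \<D>"
    and q_\<D>: "\<And>i. i < n \<Longrightarrow> q i \<notin> \<D>"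
    and q_\<U>: "\<And>i. i < n \<Longrightarrow> q i \<in> \<U> \<union> E ` {..<n}"
    and \<U>_sub: "\<U> \<subseteq> \<D> \<union> q ` {..<n}"
    and \<D>_sub: "\<D> \<subseteq> \<U> \<union> E ` {..<n}"
    and E_\<U>: "\<And>j. j < n \<Longrightarrow> E j \<notin> \<U>"
    and q_ordered: "\<And>i j. i < j \<Longrightarrow> j < n \<Longrightarrow> lies_above (q i) (q j)"
    and E_ordered: "\<And>i j. i < j \<Longrightarrow> j < n \<Longrightarrow> lies_above (E i) (E j)"
    and E_region: "\<And>v j. v \<in> \<U> \<union> \<D> \<Longrightarrow> j < n \<Longrightarrow> fst (E j) \<le> fst v \<Longrightarrow> v \<noteq> E j \<Longrightarrow> lies_above (E j) v"
    and p_E: "\<And>i j. i < n \<Longrightarrow> j < n \<Longrightarrow> p (E i) j = (if i = j then 1 else 0)"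
    and p_zero: "\<And>v j. v \<in> \<U> \<Longrightarrow> j < n \<Longrightarrow> fst (E j) \<le> fst v \<Longrightarrow> p v j = 0"
    and p_rec: "\<And>v j. v \<in> \<U> \<Longrightarrow> j < n \<Longrightarrow> p v j = w {up v, down (east v)} * p (east v) j
        + w {up v, down (southeast v)} * p (southeast v) j"
    and closed: "\<And>v t. v \<in> \<U> \<Longrightarrow> t \<in> {east v, southeast v} \<Longrightarrow>
        t \<in> \<D> \<or> t \<in> q ` {..<n} \<or> (\<forall>j<n. p t j = 0)"
    and w_vertical: "\<And>v. v \<in> \<U> \<Longrightarrow> w {up v, down v} = 1"
  shows "tiling_sum w \<U> \<D> = fdet n (\<lambda>i j. p (q i) j)"
  using assms
proof (induction "card \<U> + card \<D>" arbitrary: \<U> \<D> q rule: less_induct)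
  case less
  note fin = less.prems(1,2)
  show ?case
  proof (cases "\<U> \<union> \<D> = {}")
    case True
    then have "\<forall>i. \<exists>k. i < n \<longrightarrow> k < n \<and> q i = E k" using less.prems(4) by blast
    then obtain \<pi> where \<pi>: "\<And>i. i < n \<Longrightarrow> \<pi> i < n \<and> q i = E (\<pi> i)" by metis
    have mono: "\<pi> i < \<pi> j" if "i < j" "j < n" for i j
    proof -
      have "lies_above (E (\<pi> i)) (E (\<pi> j))" using less.prems(8)[OF that] \<pi>[of i] \<pi>[of j] that by simp
      then have "\<not> lies_above (E (\<pi> j)) (E (\<pi> i))" "E (\<pi> i) \<noteq> E (\<pi> j)"
        by (metis lies_above_asym, metis lies_above_irrefl)
      then have "\<not> \<pi> j < \<pi> i" "\<pi> i \<noteq> \<pi> j"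
        using less.prems(9)[of "\<pi> j" "\<pi> i"] \<pi>[of i] that by auto
      then show ?thesis by simp
    qed
    then have "\<pi> i = i" if "i < n" for i
      using strict_mono_self_map_eq_id[of n \<pi> i] \<pi> that by blast
    then have "fdet n (\<lambda>i j. p (q i) j) = fdet n (\<lambda>i j. if i = j then 1 else 0)"
      using \<pi> less.prems(11) by (intro fdet_cong) auto
    then show ?thesis
      using True by (simp add: fdet_identity tiling_sum_def cover_sum_empty)
  next
    case False
    define x where "x = Min (fst ` (\<U> \<union> \<D>))"
    have x_min: "x \<le> fst v" if "v \<in> \<U> \<union> \<D>" for v
      unfolding x_def using fin that by (intro Min_le) auto
    have "x \<in> fst ` (\<U> \<union> \<D>)"
      unfolding x_def using fin False by (intro Min_in) auto
    show ?thesis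
    proof (cases "\<exists>v\<in>\<D>. fst v = x")
      case True
      then obtain v where v: "v \<in> \<D>" "fst v = x" by blast
      have "v - (1, 0) \<notin> \<U>" "v - (1, -1) \<notin> \<U>"
        using x_min[of "v - (1, 0)"] x_min[of "v - (1, -1)"] v(2) by auto
      then have "{v, v - (1, 0), v - (1, -1)} \<inter> \<U> = {v} \<inter> \<U>" by blast
      then have peel: "tiling_sum w \<U> \<D> = (\<Sum>u\<in>{v} \<inter> \<U>.
          w {up u, down v} * tiling_sum w (\<U> - {u}) (\<D> - {v}))"
        using tiling_sum_peel_down[OF fin v(1), of w] by simp
      show ?thesis
      proof (cases "v \<in> \<U>")
        case True
        have "tiling_sum w \<U> \<D> = tiling_sum w (\<U> - {v}) (\<D> - {v})"
          using peel True less.prems(15)[OF True] by simp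
        also have "\<dots> = fdet n (\<lambda>i j. p (q i) j)"
        proof (rule less.hyps)
          show "card (\<U> - {v}) + card (\<D> - {v}) < card \<U> + card \<D>"
            using card_Diff1_less[OF fin(1) True] card_Diff1_less[OF fin(2) v(1)] by linarith
          show "q i \<in> (\<U> - {v}) \<union> E ` {..<n}" if "i < n" for i
            using less.prems(3,4)[OF that] v(1) by blast
          show "t \<in> \<D> - {v} \<or> t \<in> q ` {..<n} \<or> (\<forall>j<n. p t j = 0)"
            if "u \<in> \<U> - {v}" "t \<in> {east u, southeast u}" for u t
          proof -
            have "fst t = fst u + 1" using that(2) by auto
            then have "t \<noteq> v" using x_min[of u] that(1) v(2) by auto
            then show ?thesis using less.prems(14)[of u t] that by blast
          qed
        qed (use fin less.prems in auto)
        finally show ?thesis .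
      next
        case vU: False
        then obtain k where k: "k < n" "v = E k" using less.prems(6) v(1) by blast
        have "p (q i) k = 0" if i: "i < n" for i
        proof (cases "q i \<in> \<U>")
          case True
          then show ?thesis using less.prems(12)[of "q i" k] k x_min[of "q i"] v(2) by auto
        next
          case False
          then obtain l where "l < n" "q i = E l" using less.prems(4)[OF i] by blast
          moreover have "E l \<noteq> E k" using less.prems(3)[OF i] v(1) k(2) calculation by auto
          ultimately show ?thesis using less.prems(11)[of l k] k(1) by auto
        qed
        then have "fdet n (\<lambda>i j. p (q i) j) = 0" by (intro fdet_zero_column[OF k(1)])
        then show ?thesis using peel vU by simp
      qed
    next
      case no_\<D>: False
      let ?S = "{v \<in> \<U>. fst v = x}"
      have "?S \<noteq> {}" using \<open>x \<in> fst ` (\<U> \<union> \<D>)\<close> no_\<D> by auto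
      moreover have "finite ?S" using fin by simp
      ultimately obtain v where "v \<in> ?S" and top: "\<And>u. u \<in> ?S \<Longrightarrow> snd u \<le> snd v"
        using Max_in[of "snd ` ?S"] Max_ge[of "snd ` ?S"] by (auto simp: image_iff)
      then have v: "v \<in> \<U>" "fst v = x" by auto
      then have v\<D>: "v \<notin> \<D>" using no_\<D> by blast
      then obtain i where i: "i < n" "q i = v" using less.prems(5) v(1) by blast
      have q_inj: "q k \<noteq> q l" if "k < n" "l < n" "k \<noteq> l" for k l
        using less.prems(8)[of k l] less.prems(8)[of l k] that lies_above_irrefl by (metis linorder_neqE_nat)
      define F where "F t = (if t \<in> \<D> then tiling_sum w (\<U> - {v}) (\<D> - {t}) else 0)" for t
      have step: "F t = fdet n (\<lambda>k j. p ((q(i := t)) k) j)" if t: "t \<in> {east v, southeast v}" for t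
      proof (cases "t \<in> \<D>")
        case False
        then consider (coll) k where "k < n" "t = q k" | (zero) "\<forall>j<n. p t j = 0"
          using less.prems(14)[OF v(1) t] by blast
        then have "fdet n (\<lambda>k j. p ((q(i := t)) k) j) = 0"
        proof cases
          case coll
          have "fst t = fst v + 1" using t by auto
          then have "k \<noteq> i" using coll i by auto
          then show ?thesis using coll i by (intro fdet_equal_rows[of k n i]) auto
        next
          case zero
          then show ?thesis using i by (intro fdet_zero_row[of i n]) auto
        qed
        then show ?thesis using False by (simp add: F_def)
      next
        case True
        have fst_t: "fst t = x + 1" using t v(2) by auto
        have t_q: "t \<noteq> q k" if "k < n" for k using less.prems(3)[OF that] True by auto
        have "tiling_sum w (\<U> - {v}) (\<D> - {t}) = fdet n (\<lambda>k j. p ((q(i := t)) k) j)"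
        proof (rule less.hyps)
          show "card (\<U> - {v}) + card (\<D> - {t}) < card \<U> + card \<D>"
            using card_Diff1_less[OF fin(1) v(1)] card_Diff1_less[OF fin(2) True] by linarith
          show "(q(i := t)) k \<notin> \<D> - {t}" if "k < n" for k
            using less.prems(3)[OF that] by auto
          show "(q(i := t)) k \<in> (\<U> - {v}) \<union> E ` {..<n}" if "k < n" for k
            using less.prems(4)[OF that] less.prems(6) True q_inj[OF that i(1)] i(2) fst_t v(2) by auto
          show "\<U> - {v} \<subseteq> \<D> - {t} \<union> (q(i := t)) ` {..<n}"
          proof
            fix u assume u: "u \<in> \<U> - {v}"
            show "u \<in> \<D> - {t} \<union> (q(i := t)) ` {..<n}"
            proof (cases "u = t")
              case True
              then show ?thesis using i(1) by (auto intro!: image_eqI[of _ _ i])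
            next
              case False
              show ?thesis
              proof (cases "u \<in> \<D>")
                case uD: False
                then obtain k where "k < n" "u = q k" using less.prems(5) u by blast
                then show ?thesis using u i(2) by (auto intro!: image_eqI[of _ _ k])
              qed (use False in simp)
            qed
          qed
          show "\<D> - {t} \<subseteq> \<U> - {v} \<union> E ` {..<n}"
            using less.prems(6) v\<D> by blast
          show "lies_above ((q(i := t)) k) ((q(i := t)) l)" if kl: "k < l" "l < n" for k l
          proof -
            have kl_above: "lies_above (q k) (q l)" using less.prems(8)[OF kl] .
            consider "k \<noteq> i" "l \<noteq> i" | (upper) "k = i" "l \<noteq> i" | (lower) "k \<noteq> i" "l = i"
              using kl by linarith
            then show ?thesis
            proof cases
              case upper
              \<comment> \<open>A lower path cannot already have ended on the left of \<open>v\<close>, because the region lies below such a sink.\<close>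
              have "fst v \<le> fst (q l)"
              proof (rule ccontr)
                assume less_x: "\<not> fst v \<le> fst (q l)"
                then have "q l \<notin> \<U>" using x_min[of "q l"] v(2) by auto
                then obtain m where m: "m < n" "q l = E m" using less.prems(4)[OF kl(2)] by blast
                have "v \<noteq> E m" using v(1) less.prems(7)[OF m(1)] by auto
                then have "lies_above (E m) v" using less.prems(10)[of v m] v(1) m less_x by auto
                then show False using kl_above upper i(2) m(2) lies_above_asym by auto
              qed
              then show ?thesis
                using lies_above_step_upper[of v "q l" t] kl_above upper i(2) t by auto
            next
              case lower
              have "k < n" using kl by simp
              have "lies_above (q k) t"
              proof (cases "fst v < fst (q k)")
                case True
                then show ?thesis
                  using lies_above_step_lower[of "q k" v t] kl_above lower i(2) t t_q[OF \<open>k < n\<close>] by auto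
              next
                case False
                \<comment> \<open>The choice of \<open>v\<close> as uppermost in its column leaves only a sink for the upper end.\<close>
                have "q k \<notin> \<U>"
                proof
                  assume "q k \<in> \<U>"
                  then have "q k \<in> ?S" using x_min[of "q k"] v(2) False by auto
                  then have "snd (q k) \<le> snd v" by (rule top)
                  moreover have "fst (q k) = fst v" using \<open>q k \<in> ?S\<close> v(2) by simp
                  ultimately show False using kl_above lower i(2) by (simp add: lies_above_def)
                qed
                then obtain m where m: "m < n" "q k = E m" using less.prems(4)[OF \<open>k < n\<close>] by blast
                then show ?thesis
                  using less.prems(10)[of t m] True t_q[OF \<open>k < n\<close>] False fst_t v(2) by auto
              qed
              then show ?thesis using lower by simp
            qed (use kl_above in simp)
          qed
          show "s \<in> \<D> - {t} \<or> s \<in> (q(i := t)) ` {..<n} \<or> (\<forall>j<n. p s j = 0)"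
            if u: "u \<in> \<U> - {v}" and s: "s \<in> {east u, southeast u}" for u s
          proof -
            have "fst s = fst u + 1" using s by auto
            then have "s \<noteq> v" using x_min[of u] u v(2) by auto
            consider "s = t" | "s \<noteq> t" "s \<in> \<D>" | (q) k where "k < n" "s = q k" | "\<forall>j<n. p s j = 0"
              using less.prems(14)[of u s] u s by blast
            then show ?thesis
            proof cases
              case 1
              then show ?thesis using i(1) by (auto intro!: image_eqI[of _ _ i])
            next
              case q
              then have "k \<noteq> i" using \<open>s \<noteq> v\<close> i(2) by auto
              then show ?thesis using q by (auto intro!: image_eqI[of _ _ k])
            qed auto
          qed
        qed (use fin less.prems in auto)
        then show ?thesis using True by (simp add: F_def)
      qed
      have ne: "east v \<noteq> southeast v" by (cases v) simp
      have "{v, east v, southeast v} \<inter> \<D> = {east v, southeast v} \<inter> \<D>" using v\<D> by blast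
      then have "tiling_sum w \<U> \<D> = (\<Sum>t\<in>{east v, southeast v} \<inter> \<D>.
          w {up v, down t} * tiling_sum w (\<U> - {v}) (\<D> - {t}))"
        using tiling_sum_peel_up[OF fin v(1), of w] by simp
      also have "\<dots> = (\<Sum>t\<in>{east v, southeast v}. w {up v, down t} * F t)"
        by (rule sum.mono_neutral_cong_left) (auto simp: F_def)
      also have "\<dots> = w {up v, down (east v)} * F (east v) + w {up v, down (southeast v)} * F (southeast v)"
        using ne by simp
      also have "\<dots> = w {up v, down (east v)} * fdet n (\<lambda>k j. if k = i then p (east v) j else p (q k) j)
          + w {up v, down (southeast v)} * fdet n (\<lambda>k j. if k = i then p (southeast v) j else p (q k) j)"
        using step[of "east v"] step[of "southeast v"] by (simp add: if_distrib if_distribR cong: if_cong)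
      also have "\<dots> = fdet n (\<lambda>k j. if k = i then w {up v, down (east v)} * p (east v) j
          + w {up v, down (southeast v)} * p (southeast v) j else p (q k) j)"
        by (rule fdet_row_linear[OF i(1), symmetric])
      also have "\<dots> = fdet n (\<lambda>k j. p (q k) j)"
        using less.prems(13)[OF v(1)] i(2) by (intro fdet_cong) auto
      finally show ?thesis .
    qed
  qed
qed

section \<open>The cut hexagon in lattice coordinates\<close>

definition real_point :: "real \<Rightarrow> real \<Rightarrow> complex" where
  "real_point x y = of_real x * e_vec + of_real y * f_vec"

lemma point_eq_real_point: "point (x, y) = real_point (of_int x) (of_int y)"
  by (simp add: point_def real_point_def)

definition x_coord :: "complex \<Rightarrow> real" where "x_coord z = Re z - Im z / sqrt 3"
definition y_coord :: "complex \<Rightarrow> real" where "y_coord z = 2 * Im z / sqrt 3"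

lemma coord_real_point [simp]: "x_coord (real_point x y) = x" "y_coord (real_point x y) = y"
  by (simp_all add: x_coord_def y_coord_def real_point_def e_vec_def f_vec_def)

lemma linear_coord: "linear x_coord" "linear y_coord" "linear (\<lambda>z. x_coord z + y_coord z)"
  by (auto intro!: linearI simp: x_coord_def y_coord_def field_simps)

lemma hexagon_vertices:
  "hexagon a b c = convex hull {real_point 0 0, real_point b 0, real_point b a,
     real_point (b - c) (a + c), real_point (- c) (a + c), real_point (- c) c}"
  unfolding hexagon_def real_point_def g_vec_def
  by (rule arg_cong[of _ _ "(hull) convex"]) (simp add: algebra_simps)

lemma real_point_convex_combination:
  assumes "convex P" "real_point x y \<in> P" "real_point x' y' \<in> P" "0 \<le> t" "t \<le> 1"
  shows "real_point ((1 - t) * x + t * x') ((1 - t) * y + t * y') \<in> P"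
proof -
  have "(1 - t) *\<^sub>R real_point x y + t *\<^sub>R real_point x' y' \<in> P"
    using assms by (intro convexD_alt) auto
  also have "(1 - t) *\<^sub>R real_point x y + t *\<^sub>R real_point x' y'
      = real_point ((1 - t) * x + t * x') ((1 - t) * y + t * y')"
    by (simp add: real_point_def scaleR_conv_of_real algebra_simps)
  finally show ?thesis .
qed

lemma real_point_between:
  assumes "convex P" "real_point x1 y \<in> P" "real_point x2 y \<in> P" "x1 \<le> x" "x \<le> x2"
  shows "real_point x y \<in> P"
proof (cases "x1 = x2")
  case True
  then show ?thesis using assms by auto
next
  case False
  define t where "t = (x - x1) / (x2 - x1)"
  have t: "0 \<le> t" "t \<le> 1" "t * (x2 - x1) = x - x1" using assms False by (auto simp: t_def field_simps)
  have "(1 - t) * x1 + t * x2 = x" "(1 - t) * y + t * y = y" using t(3) by (simp_all add: algebra_simps)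
  then show ?thesis using real_point_convex_combination[OF assms(1-3) t(1,2)] by simp
qed

text \<open>The inequalities describe a convex set that contains the vertices. Conversely, for \<open>y\<close> between \<open>0\<close> and
  \<open>a + c\<close> the ends of the horizontal section at height \<open>y\<close> lie on the two boundary chains
  joining the bottom of the hexagon to its top, hence in the convex hull, and the section is the segment between them.\<close>

lemma real_point_in_hexagon_iff:
  assumes "0 < a" "0 < b" "0 < c"
  shows "real_point x y \<in> hexagon a b c \<longleftrightarrow>
    - real c \<le> x \<and> x \<le> real b \<and> 0 \<le> y \<and> y \<le> real a + real c \<and> 0 \<le> x + y \<and> x + y \<le> real a + real b"
proof
  let ?S = "x_coord -` {- real c..real b} \<inter> y_coord -` {0..real a + real c}
    \<inter> (\<lambda>z. x_coord z + y_coord z) -` {0..real a + real b}"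
  have "convex ?S"
    by (intro convex_Int convex_linear_vimage linear_coord) (auto simp: convex_real_interval)
  then have "hexagon a b c \<subseteq> ?S"
    unfolding hexagon_vertices by (intro hull_minimal) auto
  then show "real_point x y \<in> hexagon a b c \<Longrightarrow> - real c \<le> x \<and> x \<le> real b \<and> 0 \<le> y
      \<and> y \<le> real a + real c \<and> 0 \<le> x + y \<and> x + y \<le> real a + real b"
    by auto
next
  let ?P = "hexagon a b c"
  assume xy: "- real c \<le> x \<and> x \<le> real b \<and> 0 \<le> y \<and> y \<le> real a + real c \<and> 0 \<le> x + y \<and> x + y \<le> real a + real b"
  have P: "convex ?P" unfolding hexagon_vertices by simp
  have V: "real_point 0 0 \<in> ?P" "real_point b 0 \<in> ?P" "real_point b a \<in> ?P"
    "real_point (real b - real c) (real a + real c) \<in> ?P" "real_point (- real c) (real a + real c) \<in> ?P"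
    "real_point (- real c) c \<in> ?P"
    unfolding hexagon_vertices by (auto intro!: hull_inc)
  have left: "real_point (max (- real c) (- y)) y \<in> ?P"
  proof (cases "y \<le> c")
    case True
    then have "0 \<le> y / c" "y / c \<le> 1" using assms xy by auto
    from real_point_convex_combination[OF P V(1) V(6) this] show ?thesis using True assms by simp
  next
    case False
    then have "0 \<le> (y - c) / a" "(y - c) / a \<le> 1" using assms xy by auto
    from real_point_convex_combination[OF P V(6) V(5) this] show ?thesis
      using False assms by (simp add: field_simps)
  qed
  have right: "real_point (min (real b) (real a + real b - y)) y \<in> ?P"
  proof (cases "y \<le> a")
    case True
    then have "0 \<le> y / a" "y / a \<le> 1" using assms xy by auto
    from real_point_convex_combination[OF P V(2) V(3) this] show ?thesis
      using True assms by (simp add: field_simps)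
  next
    case False
    define t where "t = (y - a) / c"
    have t: "0 \<le> t" "t \<le> 1" "t * c = y - a" using False assms xy by (auto simp: t_def)
    have "(1 - t) * real b + t * (real b - real c) = real a + real b - y"
      "(1 - t) * real a + t * (real a + real c) = y"
      using t(3) by (simp_all add: algebra_simps)
    then show ?thesis
      using real_point_convex_combination[OF P V(3) V(4) t(1,2)] False by simp
  qed
  show "real_point x y \<in> ?P"
    by (rule real_point_between[OF P left right]) (use xy in auto)
qed

lemma point_in_hexagon_iff:
  assumes "0 < a" "0 < b" "0 < c"
  shows "point (x, y) \<in> hexagon a b c \<longleftrightarrow>
    - int c \<le> x \<and> x \<le> int b \<and> 0 \<le> y \<and> y \<le> int a + int c \<and> 0 \<le> x + y \<and> x + y \<le> int a + int b"
  unfolding point_eq_real_point real_point_in_hexagon_iff[OF assms] by linarith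

lemma unit_triangles_within:
  "{t \<in> unit_triangles. t \<subseteq> S} = up ` {v. up v \<subseteq> S} \<union> down ` {v. down v \<subseteq> S}"
  unfolding unit_triangles_eq by auto

lemma hexagon_region_eq:
  assumes "0 < a" "0 < b" "0 < c"
  shows "hexagon_region a b c =
    up ` {(x, y). - int c \<le> x \<and> x \<le> int b - 1 \<and> 0 \<le> y \<and> y \<le> int a + int c - 1 \<and> 0 \<le> x + y \<and> x + y \<le> int a + int b - 1}
    \<union> down ` {(x, y). 1 - int c \<le> x \<and> x \<le> int b \<and> 0 \<le> y \<and> y \<le> int a + int c - 1 \<and> 0 \<le> x + y \<and> x + y \<le> int a + int b - 1}"
    (is "_ = up ` ?U \<union> down ` ?D")
proof -
  have U: "up v \<subseteq> hexagon a b c \<longleftrightarrow> v \<in> ?U" for v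
    by (cases v) (auto simp: up_def point_in_hexagon_iff[OF assms])
  have D: "down v \<subseteq> hexagon a b c \<longleftrightarrow> v \<in> ?D" for v
    by (cases v) (auto simp: down_def point_in_hexagon_iff[OF assms])
  show ?thesis
    unfolding hexagon_region_def unit_triangles_within U D by simp
qed

lemma unit_triangles_in_nw_cell:
  "{u \<in> unit_triangles. u \<subseteq> point ` {v, v + (1, 0), v + (1, 1), v + (0, 1)}} = {up v, down (v + (1, 0))}"
proof -
  let ?S = "{v, v + (1, 0), v + (1, 1), v + (0, 1)}"
  have "upc u \<subseteq> ?S \<longleftrightarrow> u = v" for u by (cases u; cases v) (auto simp: upc_def)
  then have "up u \<subseteq> point ` ?S \<longleftrightarrow> u = v" for u unfolding up_eq by (simp only: inj_image_subset_iff[OF inj_map_point])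
  moreover have "downc u \<subseteq> ?S \<longleftrightarrow> u = v + (1, 0)" for u by (cases u; cases v) (auto simp: downc_def)
  then have "down u \<subseteq> point ` ?S \<longleftrightarrow> u = v + (1, 0)" for u unfolding down_eq by (simp only: inj_image_subset_iff[OF inj_map_point])
  ultimately show ?thesis unfolding unit_triangles_within by auto
qed

lemma unit_triangles_in_east_cell:
  "{u \<in> unit_triangles. u \<subseteq> point ` {v, v + (1, 0), v + (1, -1), v + (0, 1)}} = {up v, down (v + (1, -1))}"
proof -
  let ?S = "{v, v + (1, 0), v + (1, -1), v + (0, 1)}"
  have "upc u \<subseteq> ?S \<longleftrightarrow> u = v" for u by (cases u; cases v) (auto simp: upc_def)
  then have "up u \<subseteq> point ` ?S \<longleftrightarrow> u = v" for u unfolding up_eq by (simp only: inj_image_subset_iff[OF inj_map_point])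
  moreover have "downc u \<subseteq> ?S \<longleftrightarrow> u = v + (1, -1)" for u by (cases u; cases v) (auto simp: downc_def)
  then have "down u \<subseteq> point ` ?S \<longleftrightarrow> u = v + (1, -1)" for u unfolding down_eq by (simp only: inj_image_subset_iff[OF inj_map_point])
  ultimately show ?thesis unfolding unit_triangles_within by auto
qed

lemma nw_cell_eq:
  fixes a b c i j :: nat
  defines "v \<equiv> (int j - 1 - int c, int a + int c - int i)"
  shows "cell (nw_corner a b c) (- f_vec) e_vec i j = {up v, down (v + (1, 0))}"
proof -
  have "{nw_corner a b c + (of_nat i - 1) * - f_vec + (of_nat j - 1) * e_vec,
      nw_corner a b c + of_nat i * - f_vec + (of_nat j - 1) * e_vec,
      nw_corner a b c + of_nat i * - f_vec + of_nat j * e_vec,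
      nw_corner a b c + (of_nat i - 1) * - f_vec + of_nat j * e_vec}
    = point ` {v, v + (1, 0), v + (1, 1), v + (0, 1)}"
    by (simp add: v_def nw_corner_def point_def g_vec_def algebra_simps insert_commute)
  then show ?thesis unfolding cell_def by (simp only: unit_triangles_in_nw_cell)
qed

lemma east_cell_eq:
  fixes a b c i j :: nat
  defines "v \<equiv> (int b - int j, int a - int i + int j)"
  shows "cell (east_corner a b c) (- f_vec) g_vec i j = {up v, down (v + (1, -1))}"
proof -
  have "{east_corner a b c + (of_nat i - 1) * - f_vec + (of_nat j - 1) * g_vec,
      east_corner a b c + of_nat i * - f_vec + (of_nat j - 1) * g_vec,
      east_corner a b c + of_nat i * - f_vec + of_nat j * g_vec,
      east_corner a b c + (of_nat i - 1) * - f_vec + of_nat j * g_vec}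
    = point ` {v, v + (1, 0), v + (1, -1), v + (0, 1)}"
    by (simp add: v_def east_corner_def point_def g_vec_def algebra_simps insert_commute)
  then show ?thesis unfolding cell_def by (simp only: unit_triangles_in_east_cell)
qed

lemma nw_staircase_eq:
  "staircase (nw_corner a b c) (- f_vec) e_vec a =
    up ` {(x, y). - int c \<le> x \<and> y \<le> int a + int c - 1 \<and> 2 * int c + 1 \<le> y - x}
    \<union> down ` {(x, y). 1 - int c \<le> x \<and> y \<le> int a + int c - 1 \<and> 2 * int c \<le> y - x}" (is "?L = _")
proof -
  define U where "U = {(x, y). - int c \<le> x \<and> y \<le> int a + int c - 1 \<and> 2 * int c + 1 \<le> y - x}"
  define D where "D = {(x, y). 1 - int c \<le> x \<and> y \<le> int a + int c - 1 \<and> 2 * int c \<le> y - x}"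
  have "?L = up ` U \<union> down ` D"
  proof (intro equalityI subsetI)
    fix u assume "u \<in> ?L"
    then obtain i j where ij: "1 \<le> i" "1 \<le> j" "i + j \<le> a"
      and u: "u \<in> {up (int j - 1 - int c, int a + int c - int i), down ((int j - 1 - int c, int a + int c - int i) + (1, 0))}"
      unfolding staircase_def nw_cell_eq by blast
    then have "(int j - 1 - int c, int a + int c - int i) \<in> U"
      "(int j - 1 - int c, int a + int c - int i) + (1, 0) \<in> D" by (auto simp: U_def D_def)
    then show "u \<in> up ` U \<union> down ` D" using u by blast
  next
    fix u assume "u \<in> up ` U \<union> down ` D"
    then consider (up) x y where "u = up (x, y)" "(x, y) \<in> U" | (down) x y where "u = down (x, y)" "(x, y) \<in> D"
      by (metis UnE imageE prod.collapse)
    then obtain i j where "1 \<le> i" "1 \<le> j" "i + j \<le> a"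
      "u \<in> {up (int j - 1 - int c, int a + int c - int i), down ((int j - 1 - int c, int a + int c - int i) + (1, 0))}"
    proof cases
      case up
      then show ?thesis unfolding U_def D_def by (intro that[of "nat (int a + int c - y)" "nat (x + int c + 1)"]) auto
    next
      case down
      then show ?thesis unfolding U_def D_def by (intro that[of "nat (int a + int c - y)" "nat (x + int c)"]) auto
    qed
    then show "u \<in> ?L" unfolding staircase_def nw_cell_eq by blast
  qed
  then show ?thesis by (simp only: U_def D_def)
qed

lemma east_staircase_eq:
  "staircase (east_corner a b c) (- f_vec) g_vec a =
    up ` {(x, y). x \<le> int b - 1 \<and> x + y \<le> int a + int b - 1 \<and> 2 * int b \<le> 2 * x + y}
    \<union> down ` {(x, y). x \<le> int b \<and> x + y \<le> int a + int b - 1 \<and> 2 * int b + 1 \<le> 2 * x + y}" (is "?L = _")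
proof -
  define U where "U = {(x, y). x \<le> int b - 1 \<and> x + y \<le> int a + int b - 1 \<and> 2 * int b \<le> 2 * x + y}"
  define D where "D = {(x, y). x \<le> int b \<and> x + y \<le> int a + int b - 1 \<and> 2 * int b + 1 \<le> 2 * x + y}"
  have "?L = up ` U \<union> down ` D"
  proof (intro equalityI subsetI)
    fix u assume "u \<in> ?L"
    then obtain i j where ij: "1 \<le> i" "1 \<le> j" "i + j \<le> a"
      and u: "u \<in> {up (int b - int j, int a - int i + int j), down ((int b - int j, int a - int i + int j) + (1, -1))}"
      unfolding staircase_def east_cell_eq by blast
    then have "(int b - int j, int a - int i + int j) \<in> U"
      "(int b - int j, int a - int i + int j) + (1, -1) \<in> D" by (auto simp: U_def D_def)
    then show "u \<in> up ` U \<union> down ` D" using u by blast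
  next
    fix u assume "u \<in> up ` U \<union> down ` D"
    then consider (up) x y where "u = up (x, y)" "(x, y) \<in> U" | (down) x y where "u = down (x, y)" "(x, y) \<in> D"
      by (metis UnE imageE prod.collapse)
    then obtain i j where "1 \<le> i" "1 \<le> j" "i + j \<le> a"
      "u \<in> {up (int b - int j, int a - int i + int j), down ((int b - int j, int a - int i + int j) + (1, -1))}"
    proof cases
      case up
      then show ?thesis unfolding U_def D_def by (intro that[of "nat (int a + int b - x - y)" "nat (int b - x)"]) auto
    next
      case down
      then show ?thesis unfolding U_def D_def by (intro that[of "nat (int a + int b - x - y)" "nat (int b + 1 - x)"]) auto
    qed
    then show "u \<in> ?L" unfolding staircase_def east_cell_eq by blast
  qed
  then show ?thesis by (simp only: U_def D_def)
qed
text \<open>The inequality \<open>y - x \<le> 2c\<close> is the effect of the northwestern cut and \<open>2x + y \<le> 2b - 1\<close> that of the eastern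
  cut. For downward triangles the bounds are off by one, and the differences between the two
  regions are exactly the sources and the sinks of the paths.\<close>

definition up_region :: "nat \<Rightarrow> nat \<Rightarrow> nat \<Rightarrow> point set" where
  "up_region a b c = {(x, y). - int c \<le> x \<and> x \<le> int b - 1 \<and> 0 \<le> y \<and> y \<le> int a + int c - 1
     \<and> 0 \<le> x + y \<and> x + y \<le> int a + int b - 1 \<and> y - x \<le> 2 * int c \<and> 2 * x + y \<le> 2 * int b - 1}"

definition down_region :: "nat \<Rightarrow> nat \<Rightarrow> nat \<Rightarrow> point set" where
  "down_region a b c = {(x, y). 1 - int c \<le> x \<and> x \<le> int b \<and> 0 \<le> y \<and> y \<le> int a + int c - 1
     \<and> 0 \<le> x + y \<and> x + y \<le> int a + int b - 1 \<and> y - x \<le> 2 * int c - 1 \<and> 2 * x + y \<le> 2 * int b}"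

lemma up_down_image_diff:
  "(up ` U \<union> down ` D) - (up ` U' \<union> down ` D') = up ` (U - U') \<union> down ` (D - D')"
proof -
  have "up ` U - (up ` U' \<union> down ` D') = up ` (U - U')" by (auto simp: up_inj up_neq_down)
  moreover have "down ` D - (up ` U' \<union> down ` D') = down ` (D - D')"
    by (auto simp: down_inj up_neq_down[symmetric])
  ultimately show ?thesis by (simp add: Un_Diff)
qed

lemma H_d_eq:
  assumes "0 < a" "a \<le> b" "b \<le> c"
  shows "H_d a b c = up ` up_region a b c \<union> down ` down_region a b c"
proof -
  have "min a b = a" "min a c = a" "0 < b" "0 < c" using assms by auto
  then show ?thesis
    unfolding H_d_def up_region_def down_region_def
    by (simp only: hexagon_region_eq[OF assms(1)] nw_staircase_eq east_staircase_eq up_down_image_diff)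
       (intro arg_cong2[of _ _ _ _ "(\<union>)"] arg_cong[of _ _ "(`) up"] arg_cong[of _ _ "(`) down"]; auto)
qed

text \<open>The marked lozenges are those that leave the sources of the paths by a step \<open>(1, 0)\<close>.\<close>

lemma nw_marked_eq:
  assumes "a \<le> b"
  shows "nw_marked a b c = (\<lambda>i. {up (int a - int c - int i, int a + int c - int i),
    down ((int a - int c - int i, int a + int c - int i) + (1, 0))}) ` {1..a}"
proof -
  have "min a b = a" using assms by simp
  then have "nw_marked a b c = {{up (int j - 1 - int c, int a + int c - int i),
      down ((int j - 1 - int c, int a + int c - int i) + (1, 0))} |i j. 1 \<le> i \<and> 1 \<le> j \<and> i + j = a + 1}"
    unfolding nw_marked_def marked_positions_def nw_cell_eq by simp
  also have "\<dots> = (\<lambda>i. {up (int a - int c - int i, int a + int c - int i),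
    down ((int a - int c - int i, int a + int c - int i) + (1, 0))}) ` {1..a}" (is "_ = ?f ` _")
  proof (intro equalityI subsetI)
    fix l assume "l \<in> {{up (int j - 1 - int c, int a + int c - int i),
      down ((int j - 1 - int c, int a + int c - int i) + (1, 0))} |i j. 1 \<le> i \<and> 1 \<le> j \<and> i + j = a + 1}"
    then obtain i j where l: "l = {up (int j - 1 - int c, int a + int c - int i),
      down ((int j - 1 - int c, int a + int c - int i) + (1, 0))}" and ij: "1 \<le> i" "1 \<le> j" "i + j = a + 1" by blast
    have "int j - 1 - int c = int a - int c - int i" using ij by linarith
    then have "l = ?f i" using l by (simp only:)
    then show "l \<in> ?f ` {1..a}" using ij by simp
  next
    fix l assume "l \<in> ?f ` {1..a}"
    then obtain i where i: "1 \<le> i" "i \<le> a" "l = ?f i" by auto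
    have "int (a + 1 - i) - 1 - int c = int a - int c - int i" using i by simp
    then have "l = {up (int (a + 1 - i) - 1 - int c, int a + int c - int i),
      down ((int (a + 1 - i) - 1 - int c, int a + int c - int i) + (1, 0))}" using i(3) by (simp only:)
    moreover have "1 \<le> a + 1 - i" "i + (a + 1 - i) = a + 1" using i by auto
    ultimately show "l \<in> {{up (int j - 1 - int c, int a + int c - int i),
      down ((int j - 1 - int c, int a + int c - int i) + (1, 0))} |i j. 1 \<le> i \<and> 1 \<le> j \<and> i + j = a + 1}"
      using i(1) by blast
  qed
  finally show ?thesis .
qed

section \<open>The weighted count of tilings of the cut hexagon\<close>

text \<open>The number of paths with \<open>n\<close> steps of which \<open>k\<close> go down. Integer arguments make it vanish when the
  target is out of reach.\<close>

definition paths :: "int \<Rightarrow> int \<Rightarrow> real" where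
  "paths n k = (if 0 \<le> n \<and> 0 \<le> k then real (nat n choose nat k) else 0)"

lemma paths_0: "paths 0 k = (if k = 0 then 1 else 0)"
  by (auto simp: paths_def binomial_eq_0)

lemma paths_eq_0: "n < k \<or> k < 0 \<or> n < 0 \<Longrightarrow> paths n k = 0"
  by (auto simp: paths_def binomial_eq_0)

lemma paths_rec:
  assumes "n \<noteq> 0 \<or> k \<noteq> 0"
  shows "paths n k = paths (n - 1) k + paths (n - 1) (k - 1)"
proof (cases "0 < n \<and> 0 < k")
  case True
  then have "nat n = Suc (nat (n - 1))" "nat k = Suc (nat (k - 1))" by auto
  then show ?thesis using True by (simp add: paths_def)
next
  case False
  show ?thesis
  proof (cases "n \<le> 0 \<or> k < 0")
    case True
    then show ?thesis using assms False by (auto simp: paths_def binomial_eq_0)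
  next
    case 2: False
    then have "k = 0" using False by auto
    then show ?thesis using 2 by (simp add: paths_def)
  qed
qed

text \<open>A binomial coefficient outside its range vanishes because one of the two reciprocal Gamma functions
  has its argument at a nonpositive integer.\<close>

lemma paths_Gamma:
  assumes "0 \<le> n"
  shows "paths n k = Gamma (of_int n + 1) * rGamma (of_int k + 1) * rGamma (of_int n - of_int k + 1)"
proof (cases "0 \<le> k \<and> k \<le> n")
  case True
  define m l where "m = nat n" and "l = nat k"
  have ml: "n = int m" "k = int l" "l \<le> m" using True by (auto simp: m_def l_def)
  have G: "Gamma (real i + 1) = fact i" "rGamma (real i + 1) = inverse (fact i)" for i
    using Gamma_fact[of i, where 'a = real] by (simp_all add: add.commute rGamma_inverse_Gamma)
  have "real m - real l + 1 = real (m - l) + 1" using ml by simp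
  then show ?thesis
    unfolding paths_def ml of_int_of_nat_eq
    by (simp only: G) (use ml in \<open>simp add: binomial_fact field_simps\<close>)
next
  case False
  have zero: "rGamma (of_int i + 1 :: real) = 0" if "i < 0" for i
  proof -
    have "of_int i + 1 = (of_int (i + 1) :: real)" by simp
    moreover have "(of_int (i + 1) :: real) \<in> \<int>\<^sub>\<le>\<^sub>0" using that by (intro nonpos_Ints_of_int) simp
    ultimately show ?thesis by (simp only: rGamma_eq_zero_iff)
  qed
  have "rGamma (of_int k + 1 :: real) = 0 \<or> rGamma (of_int n - of_int k + 1 :: real) = 0"
    using zero[of k] zero[of "n - k"] False assms by auto
  then show ?thesis using False assms by (auto simp: paths_def binomial_eq_0)
qed

text \<open>The numbers of paths whose first step is horizontal or descending are \<open>(n - k)/n\<close> and \<open>k/n\<close> of all paths.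
  Weighting the former by \<open>1/2\<close> leaves the fraction \<open>(n + k)/(2n)\<close>.\<close>

lemma half_weighted_paths:
  assumes "1 \<le> n"
  shows "1 / 2 * paths (n - 1) k + paths (n - 1) (k - 1) =
    1 / 2 * of_int (n + k) * (Gamma (of_int n) * rGamma (of_int n - of_int k + 1) * rGamma (of_int k + 1))"
proof -
  have "paths (n - 1) k = Gamma (of_int n) * rGamma (of_int k + 1) * rGamma (of_int n - of_int k)"
    "paths (n - 1) (k - 1) = Gamma (of_int n) * rGamma (of_int k) * rGamma (of_int n - of_int k + 1)"
    using assms paths_Gamma[of "n - 1" k] paths_Gamma[of "n - 1" "k - 1"] by simp_all
  then show ?thesis
    unfolding rGamma_step[of "of_int k"] rGamma_step[of "of_int n - of_int k"]
    by (simp add: algebra_simps)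
qed

lemma fdet_scale_columns: "fdet n (\<lambda>i j. c j * f i j) = (\<Prod>j<n. c j) * fdet n f"
proof -
  have "(\<Prod>i = 0..<n. c (p i) * f i (p i)) = (\<Prod>j<n. c j) * (\<Prod>i = 0..<n. f i (p i))"
    if "p permutes {0..<n}" for p
    using prod.permute[OF that, of c] by (simp add: prod.distrib o_def lessThan_atLeast0)
  then show ?thesis
    unfolding fdet_eq_sum_permutes sum_distrib_left by (intro sum.cong) (auto simp: mult.left_commute)
qed

lemma prod_half_eq_power_card:
  assumes "finite T"
  shows "(\<Prod>l\<in>T. if l \<in> M then 1 / 2 else 1) = (1 / 2 ^ card (T \<inter> M) :: real)"
proof -
  have "(\<Prod>l\<in>T. if l \<in> M then 1 / 2 else 1) = (\<Prod>l\<in>T \<inter> M. 1 / 2 :: real)"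
    using assms by (rule prod.inter_restrict[symmetric])
  then show ?thesis by (simp add: power_one_over)
qed

lemma finite_regions: "finite (up_region a b c)" "finite (down_region a b c)"
  by (rule finite_subset[of _ "{- int c..int b} \<times> {0..int a + int c}"];
      auto simp: up_region_def down_region_def)+

lemma L_star_eq_tiling_sum:
  assumes "0 < a" "a \<le> b" "b \<le> c"
  shows "L_star a b c = tiling_sum (\<lambda>l. if l \<in> nw_marked a b c then 1 / 2 else 1)
    (up_region a b c) (down_region a b c)"
proof -
  have "finite (H_d a b c)"
    unfolding H_d_eq[OF assms] by (simp add: finite_regions)
  then have "finite T" if "partition_on (H_d a b c) T" for T
    using finite_elements that by blast
  then show ?thesis
    unfolding L_star_def tiling_sum_def cover_sum_def H_d_eq[OF assms, symmetric] lozenge_tilings_def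
    by (intro sum.cong) (auto simp: prod_half_eq_power_card)
qed

text \<open>The path numbers \<open>p\<^sub>0\<close> count unweighted paths. A source is the only kind of point of the region with
  \<open>y - x = 2c\<close>, no step leads to such a point, and only there the first step is weighted; this gives the
  weighted numbers \<open>p\<close>.\<close>

lemma L_star_eq_fdet:
  assumes "0 < a" "a \<le> b" "b \<le> c"
  shows "L_star a b c = fdet a (\<lambda>i j.
    1 / 2 * paths (int b + int c - 2 * int a + int i + int j + 1) (int c - int a + 1 + 2 * int j - int i)
    + paths (int b + int c - 2 * int a + int i + int j + 1) (int c - int a + 2 * int j - int i))"
proof -
  let ?U = "up_region a b c" and ?D = "down_region a b c"
  define w where "w = (\<lambda>l. if l \<in> nw_marked a b c then 1 / 2 else 1 :: real)"
  define q where "q i = (int a - int c - int i - 1, int a + int c - int i - 1)" for i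
  define E where "E j = (int b - int a + int j + 1, 2 * int a - 2 * int j - 2)" for j
  define p\<^sub>0 where "p\<^sub>0 v j = paths (int b - int a + int j + 1 - fst v) (snd v - 2 * int a + 2 * int j + 2)"
    for v :: point and j :: nat
  define p where "p v j = (if snd v - fst v = 2 * int c then 1 / 2 * p\<^sub>0 (east v) j + p\<^sub>0 (southeast v) j else p\<^sub>0 v j)"
    for v j
  note region = up_region_def down_region_def
  have source: "v \<in> q ` {..<a} \<longleftrightarrow> v \<in> ?U \<and> snd v - fst v = 2 * int c" for v
  proof
    assume "v \<in> q ` {..<a}"
    then show "v \<in> ?U \<and> snd v - fst v = 2 * int c"
      using assms by (auto simp: q_def up_region_def)
  next
    assume v: "v \<in> ?U \<and> snd v - fst v = 2 * int c"
    obtain x y where xy: "v = (x, y)" by (cases v)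
    have "v = q (nat (int a + int c - 1 - y))" "nat (int a + int c - 1 - y) < a"
      using v xy by (auto simp: q_def up_region_def)
    then show "v \<in> q ` {..<a}" by blast
  qed
  \<comment> \<open>A downward triangle without its partner has \<open>2x + y = 2b\<close>, or \<open>x = b\<close> and \<open>y = 0\<close>; both are sinks.\<close>
  have sink: "v \<in> ?D \<Longrightarrow> v \<notin> ?U \<Longrightarrow> v \<in> E ` {..<a}" for v
  proof -
    assume v: "v \<in> ?D" "v \<notin> ?U"
    obtain x y where xy: "v = (x, y)" by (cases v)
    have "v = E (nat (x + int a - int b - 1))" "nat (x + int a - int b - 1) < a"
      using v xy assms by (auto simp: E_def region)
    then show "v \<in> E ` {..<a}" by blast
  qed
  have marked: "{up v, down t} \<in> nw_marked a b c \<longleftrightarrow> v \<in> q ` {..<a} \<and> t = east v" for v t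
  proof -
    have "nw_marked a b c = (\<lambda>v. {up v, down (east v)}) ` (\<lambda>i. (int a - int c - int i, int a + int c - int i)) ` {1..a}"
      unfolding nw_marked_eq[OF assms(2)] image_image by (rule refl)
    also have "(\<lambda>i. (int a - int c - int i, int a + int c - int i)) ` {1..a} = q ` {..<a}"
      unfolding image_Suc_lessThan[symmetric] image_image q_def by (rule image_cong) auto
    finally show ?thesis
      by (auto simp: doubleton_eq_iff up_inj down_inj up_neq_down up_neq_down[symmetric])
  qed
  have p_source: "p v j = 1 / 2 * p\<^sub>0 (east v) j + p\<^sub>0 (southeast v) j" if "v \<in> q ` {..<a}" for v j
    using that source[of v] by (simp add: p_def)
  have p_target: "p t j = p\<^sub>0 t j" if "v \<in> ?U" "t = east v \<or> t = southeast v" for v t j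
    using that by (cases v) (auto simp: p_def up_region_def)
  have p\<^sub>0_rec: "p\<^sub>0 v j = p\<^sub>0 (east v) j + p\<^sub>0 (southeast v) j" if "v \<noteq> E j" for v j
  proof -
    obtain x y where xy: "v = (x, y)" by (cases v)
    let ?n = "int b - int a + int j + 1 - x" and ?k = "y - 2 * int a + 2 * int j + 2"
    have "?n \<noteq> 0 \<or> ?k \<noteq> 0" using that xy by (auto simp: E_def)
    from paths_rec[OF this] show ?thesis
      unfolding p\<^sub>0_def xy by (simp add: algebra_simps)
  qed
  have "tiling_sum w ?U ?D = fdet a (\<lambda>i j. p (q i) j)"
  proof (rule tiling_sum_eq_fdet[where E = E])
    show "finite ?U" "finite ?D" by (rule finite_regions)+
    show "q i \<notin> ?D" if "i < a" for i
      using that by (auto simp: q_def down_region_def)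
    show "q i \<in> ?U \<union> E ` {..<a}" if "i < a" for i
      using that source[of "q i"] by auto
    show "?U \<subseteq> ?D \<union> q ` {..<a}"
    proof
      fix v assume v: "v \<in> ?U"
      obtain x y where xy: "v = (x, y)" by (cases v)
      show "v \<in> ?D \<union> q ` {..<a}"
      proof (cases "y - x = 2 * int c")
        case True
        then show ?thesis using source[of v] v xy by simp
      next
        case False
        then show ?thesis using v xy by (auto simp: region)
      qed
    qed
    show "?D \<subseteq> ?U \<union> E ` {..<a}" using sink by blast
    show "E j \<notin> ?U" if "j < a" for j
      by (auto simp: E_def up_region_def)
    show "lies_above (q i) (q j)" if "i < j" "j < a" for i j
      using that by (auto simp: lies_above_def q_def)
    show "lies_above (E i) (E j)" if "i < j" "j < a" for i j
      using that by (auto simp: lies_above_def E_def)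
    show "lies_above (E j) v" if "v \<in> ?U \<union> ?D" "j < a" "fst (E j) \<le> fst v" "v \<noteq> E j" for v j
      using that by (cases v) (auto simp: lies_above_def E_def region)
    show "p (E i) j = (if i = j then 1 else 0)" if "i < a" "j < a" for i j
    proof -
      have "p (E i) j = p\<^sub>0 (E i) j" using that assms by (auto simp: p_def E_def)
      then show ?thesis
        by (cases "j < i") (auto simp: p\<^sub>0_def E_def paths_0 paths_eq_0)
    qed
    show "p v j = 0" if "v \<in> ?U" "j < a" "fst (E j) \<le> fst v" for v j
    proof -
      obtain x y where xy: "v = (x, y)" by (cases v)
      have "p v j = p\<^sub>0 v j" using that xy assms by (auto simp: p_def E_def up_region_def)
      moreover have "y - 2 * int a + 2 * int j + 2 \<noteq> 0 \<or> int b - int a + int j + 1 - x < 0"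
        using that xy by (auto simp: E_def up_region_def)
      ultimately show ?thesis
        using that xy by (cases "int b - int a + int j + 1 - x = 0") (auto simp: p\<^sub>0_def E_def paths_0 paths_eq_0)
    qed
    show "p v j = w {up v, down (east v)} * p (east v) j + w {up v, down (southeast v)} * p (southeast v) j"
      if v: "v \<in> ?U" and j: "j < a" for v j
    proof -
      have ne: "southeast v \<noteq> east v" by (cases v) simp
      have "v \<noteq> E j" using v by (auto simp: E_def up_region_def)
      then show ?thesis
        using p\<^sub>0_rec[of v j] p_source[of v j] p_target[OF v, of "east v" j] p_target[OF v, of "southeast v" j] source[of v] v ne
        by (cases "v \<in> q ` {..<a}") (simp_all add: w_def marked p_def)
    qed
    show "t \<in> ?D \<or> t \<in> q ` {..<a} \<or> (\<forall>j<a. p t j = 0)"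
      if v: "v \<in> ?U" and t: "t \<in> {east v, southeast v}" for v t
    proof (cases "t \<in> ?D")
      case False
      obtain x y where xy: "v = (x, y)" by (cases v)
      have "p\<^sub>0 t j = 0" if "j < a" for j
        unfolding p\<^sub>0_def using v t xy False that assms
        by (intro paths_eq_0) (auto simp: region)
      then show ?thesis using p_target[OF v, of t] t by auto
    qed simp
    show "w {up v, down v} = 1" if "v \<in> ?U" for v
      by (cases v) (simp add: w_def marked)
  qed
  also have "\<dots> = fdet a (\<lambda>i j.
    1 / 2 * paths (int b + int c - 2 * int a + int i + int j + 1) (int c - int a + 1 + 2 * int j - int i)
    + paths (int b + int c - 2 * int a + int i + int j + 1) (int c - int a + 2 * int j - int i))"
    by (rule fdet_cong) (simp add: p_source p\<^sub>0_def q_def algebra_simps)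
  finally show ?thesis using L_star_eq_tiling_sum[OF assms] by (simp add: w_def)
qed

lemma mrr_factor_nat:
  assumes "a \<le> b" "a \<le> c"
  shows "mrr_factor (real b - real a + 1) (real c - real a + 1) i =
    fact i * fact (b + c - 2 * a + Suc i) / fact (c - a + 2 * Suc i - 1)
    * (pochhammer (real b + 2 * real c - 3 * real a + 2 * real (Suc i) + 1) i
       * pochhammer (2 * real b + real c - 3 * real a + 2 * real (Suc i) + 1) i
       / fact (b - a + 2 * Suc i - 1))"
proof -
  have G: "Gamma (real n + 1) = fact n" "rGamma (real n + 1) = inverse (fact n)" for n
    using Gamma_fact[of n, where 'a = real] by (simp_all add: add.commute rGamma_inverse_Gamma)
  have "real b - real a + 1 + (real c - real a + 1) + real i = real (b + c - 2 * a + Suc i) + 1"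
    "real b - real a + 1 + 2 * real i + 1 = real (b - a + 2 * Suc i - 1) + 1"
    "real c - real a + 1 + 2 * real i + 1 = real (c - a + 2 * Suc i - 1) + 1"
    "2 * (real b - real a + 1) + (real c - real a + 1) + 2 * real i = 2 * real b + real c - 3 * real a + 2 * real (Suc i) + 1"
    "real b - real a + 1 + 2 * (real c - real a + 1) + 2 * real i = real b + 2 * real c - 3 * real a + 2 * real (Suc i) + 1"
    using assms by (simp_all add: of_nat_diff algebra_simps)
  then show ?thesis
    unfolding mrr_factor_def by (simp only: G divide_inverse mult.assoc mult.commute mult.left_commute)
qed

theorem proposition1p3:
  fixes a b c :: nat
  assumes "0 < a" and "a \<le> b" and "b \<le> c"
  shows "L_star a b c =
    1 / 2 ^ a *
    (\<Prod>j = 1..a.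
       (fact (j - 1) * (real b + 2 * real c - 3 * real a + 3 * real j) * fact (b + c - 2 * a + j)
          / fact (c - a + 2 * j - 1))
     * (pochhammer (real b + 2 * real c - 3 * real a + 2 * real j + 1) (j - 1)
        * pochhammer (2 * real b + real c - 3 * real a + 2 * real j + 1) (j - 1)
          / fact (b - a + 2 * j - 1)))"
proof -
  define x y where "x = real b - real a + 1" and "y = real c - real a + 1"
  define h where "h j = 1 / 2 * (real b + 2 * real c - 3 * real a + 3 * real (Suc j))" for j
  have xy: "x = of_int (int b - int a + 1)" "y = of_int (int c - int a + 1)" by (simp_all add: x_def y_def)
  have "L_star a b c = fdet a (\<lambda>i j. h j * mrr_entry x y i j)"
    unfolding L_star_eq_fdet[OF assms]
  proof (rule fdet_cong)
    fix i j
    define n k where "n = int b + int c - 2 * int a + int i + int j + 2" and "k = int c - int a + 1 + 2 * int j - int i"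
    have "1 \<le> n" using assms by (simp add: n_def)
    have nk: "n - 1 = int b + int c - 2 * int a + int i + int j + 1"
      "k - 1 = int c - int a + 2 * int j - int i" by (simp_all add: n_def k_def)
    have "1 / 2 * paths (int b + int c - 2 * int a + int i + int j + 1) (int c - int a + 1 + 2 * int j - int i)
        + paths (int b + int c - 2 * int a + int i + int j + 1) (int c - int a + 2 * int j - int i)
      = 1 / 2 * paths (n - 1) k + paths (n - 1) (k - 1)"
      unfolding k_def[symmetric] nk by (rule refl)
    also have "\<dots> = 1 / 2 * of_int (n + k) * (Gamma (of_int n) * rGamma (of_int n - of_int k + 1) * rGamma (of_int k + 1))"
      by (rule half_weighted_paths) fact
    also have "1 / 2 * of_int (n + k) = h j" by (simp add: h_def n_def k_def)
    also have "Gamma (of_int n) * rGamma (of_int n - of_int k + 1) * rGamma (of_int k + 1) = mrr_entry x y i j"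
      unfolding mrr_entry_def x_def y_def by (simp add: n_def k_def algebra_simps)
    finally show "1 / 2 * paths (int b + int c - 2 * int a + int i + int j + 1) (int c - int a + 1 + 2 * int j - int i)
        + paths (int b + int c - 2 * int a + int i + int j + 1) (int c - int a + 2 * int j - int i)
      = h j * mrr_entry x y i j" .
  qed
  also have "\<dots> = (\<Prod>j<a. h j) * mrr_product a x y"
    unfolding fdet_scale_columns xy by (subst fdet_mrr) (use assms in auto)
  also have "\<dots> = (\<Prod>j<a. 1 / 2 * ((real b + 2 * real c - 3 * real a + 3 * real (Suc j)) * mrr_factor x y j))"
    by (simp add: mrr_product_def h_def prod.distrib[symmetric] mult.assoc)
  also have "\<dots> = 1 / 2 ^ a * (\<Prod>j<a. (real b + 2 * real c - 3 * real a + 3 * real (Suc j)) * mrr_factor x y j)"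
    unfolding prod.distrib by (simp add: power_one_over)
  finally have L: "L_star a b c
    = 1 / 2 ^ a * (\<Prod>j<a. (real b + 2 * real c - 3 * real a + 3 * real (Suc j)) * mrr_factor x y j)" .
  have "(real b + 2 * real c - 3 * real a + 3 * real (Suc j)) * mrr_factor x y j =
      (fact (Suc j - 1) * (real b + 2 * real c - 3 * real a + 3 * real (Suc j)) * fact (b + c - 2 * a + Suc j)
          / fact (c - a + 2 * Suc j - 1))
     * (pochhammer (real b + 2 * real c - 3 * real a + 2 * real (Suc j) + 1) (Suc j - 1)
        * pochhammer (2 * real b + real c - 3 * real a + 2 * real (Suc j) + 1) (Suc j - 1)
          / fact (b - a + 2 * Suc j - 1))" for j
    unfolding x_def y_def mrr_factor_nat[OF assms(2) order.trans[OF assms(2,3)]] diff_Suc_1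
    by (simp only: divide_inverse mult.assoc mult.commute mult.left_commute)
  then show ?thesis
    unfolding L by (simp only: One_nat_def prod.atLeast1_atMost_eq)
qed

end
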